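(* Let $G=\mathrm{GL}_2$, let $T$ be the diagonal torus, and let $\gamma\in\mathfrak t(\mathcal O)$ be a regular element of root valuation $n=\mathrm{val}(\alpha_{12}(\gamma))\ge1$. Then the orbital integral is $I_\gamma^G=q^n$. For every sufficiently large $a\in\mathbf N$, with $\Pi$ the $(G,T)$-orthogonal family defined by $\lambda_w(\Pi)=\lambda_w(\Sigma_\gamma)+w(a\,\alpha_{12}^\vee)$ for $w\in W$, $$|\mathcal X_\gamma^0(\Pi)(\mathbf F_q)|=\sum_{i=0}^n q^i+2a\,q^n,$$ and Arthur's weighted orbital integral $J_T(\gamma)$ equals $$J_T(\gamma)=\mathrm{vol}\big(\mathfrak a^{\mathrm{SL}_2}_{T_{\mathrm{SL}_2}}/X_*(T_{\mathrm{SL}_2})\big)\cdot\Big[n\,q^n-\sum_{i=0}^{n-1}q^i\Big],$$ where $T_{\mathrm{SL}_2}=T\cap\mathrm{SL}_2$.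
   Context: $F=\mathbf F_q((\epsilon))$, $\mathcal O=\mathbf F_q[[\epsilon]]$, $\mathrm{val}(\epsilon)=1$, $\mathrm{char}(\mathbf F_q)>2$, $K=G(\mathcal O)$; $\mathfrak g,\mathfrak t$ are the Lie algebras of $G,T$. $\alpha_{12}(\mathrm{diag}(\gamma_1,\gamma_2))=\gamma_1-\gamma_2$, $\alpha_{12}^\vee=(1,-1)\in X_*(T)=\mathbf Z^2$, $W=\mathfrak S_2$. $\mathcal X=G(F)/K$, $\mathcal X_\gamma=\{[g]\in\mathcal X:\mathrm{Ad}(g^{-1})\gamma\in\mathfrak g(\mathcal O)\}$, and $\mathcal X_\gamma^0=\{[g]\in\mathcal X_\gamma:\mathrm{val}(\det g)=0\}$. For a Borel subgroup $B=TN$ containing $T$, $H_B(g)\in X_*(T)\subset\mathfrak a_T=\mathbf R^2$ is defined by $H_B(ntk)=(\mathrm{val}(t_1),\mathrm{val}(t_2))$ for $n\in N(F)$, $t=\mathrm{diag}(t_1,t_2)\in T(F)$, $k\in K$. Let $B_0$ be the upper triangular Borel subgroup and $B_0^-$ the opposite one. $\mathrm{Ec}(g)$ is the segment with end points $H_{B_0}(g),H_{B_0^-}(g)$. A point $[g]\in\mathcal X_\gamma$ is regular if it lies in the $T(F)$-stable dense open subset on which $n(x):=$ the integer with $H_{B_0}(x)-H_{B_0^-}(x)=n(x)\alpha_{12}^\vee$ attains its maximal value $n$. Fix a regular $x_0\in\mathcal X_\gamma^0$; $\Sigma_\gamma=\mathrm{Ec}(x_0)$, with vertices $\lambda_1(\Sigma_\gamma)=H_{B_0}(x_0)$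 and $\lambda_s(\Sigma_\gamma)=H_{B_0^-}(x_0)=H_{B_0}(x_0)-n\alpha_{12}^\vee$ ($s$ the non-trivial element of $W$). $\Pi$ also denotes the segment joining $\lambda_1(\Pi)$ and $\lambda_s(\Pi)$, and $\mathcal X_\gamma^0(\Pi)=\{x\in\mathcal X_\gamma^0:\mathrm{Ec}(x)\subset\Pi\}$. $\mathfrak a_T^G=\{(x,-x)\}\subset\mathfrak a_T$, identified with $\mathfrak a^{\mathrm{SL}_2}_{T_{\mathrm{SL}_2}}=X_*(T_{\mathrm{SL}_2})\otimes\mathbf R$, carries a fixed $W$-invariant inner product and the Lebesgue measure for which the lattice generated by a unit vector has covolume $1$. $\mathrm v_T(g)$ is the length of the projection of $\mathrm{Ec}(g)$ to $\mathfrak a_T^G$. Haar measures: $\mathrm{vol}(K)=1$, $\mathrm{vol}(T(\mathcal O))=1$. Then $$I_\gamma^G=\int_{T(F)\backslash G(F)}\mathbf 1_{\mathfrak g(\mathcal O)}(\mathrm{Ad}(g^{-1})\gamma)\frac{dg}{dt},\qquad J_T(\gamma)=\int_{T(F)\backslash G(F)}\mathbf 1_{\mathfrak g(\mathcal O)}(\mathrm{Ad}(g)^{-1}\gamma)\,\mathrm v_T(g)\frac{dg}{dt}.$$ *)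

theory Defs
  imports
    "HOL-Analysis.Analysis"
    "HOL-Computational_Algebra.Computational_Algebra"
begin

section \<open>The local field and the groups\<close>

text \<open>
  The residue field is \<open>'a :: {field, finite}\<close>, so \<open>q = CARD('a)\<close>, and \<open>F = 'a fls\<close> with
  valuation \<open>fls_subdegree\<close> (on nonzero series; note \<open>fls_subdegree 0 = 0\<close>).  The metric of
  \<open>'a fls\<close> in the library is the \<open>\<epsilon>\<close>-adic one, hence \<open>borel\<close> on \<open>'a fls ^ 2 ^ 2\<close> is the
  Borel algebra of the \<open>\<epsilon>\<close>-adic topology.
\<close>

type_synonym 'a mat2 = "'a fls ^ 2 ^ 2"

definition integers :: "'a::{field,finite} fls set" where
  "integers = range fps_to_fls"

definition gl2_int :: "'a::{field,finite} mat2 set" where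
  "gl2_int = {A. \<forall>i j. A $ i $ j \<in> integers}"

definition GL2_F :: "'a::{field,finite} mat2 set" where
  "GL2_F = {g. invertible g}"

definition GL2_O :: "'a::{field,finite} mat2 set" where
  "GL2_O = {k \<in> gl2_int. \<exists>k' \<in> gl2_int. k ** k' = mat 1 \<and> k' ** k = mat 1}"

definition torus_F :: "'a::{field,finite} mat2 set" where
  "torus_F = {t \<in> GL2_F. t $ 1 $ 2 = 0 \<and> t $ 2 $ 1 = 0}"

definition torus_O :: "'a::{field,finite} mat2 set" where
  "torus_O = torus_F \<inter> GL2_O"

definition torus_lie_O :: "'a::{field,finite} mat2 set" where
  "torus_lie_O = {A \<in> gl2_int. A $ 1 $ 2 = 0 \<and> A $ 2 $ 1 = 0}"

definition alpha12 :: "'a::{field,finite} mat2 \<Rightarrow> 'a fls" where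
  "alpha12 A = A $ 1 $ 1 - A $ 2 $ 2"

definition regular_element :: "'a::{field,finite} mat2 \<Rightarrow> bool" where
  "regular_element \<gamma> \<longleftrightarrow> alpha12 \<gamma> \<noteq> 0"

definition Ad :: "'a::{field,finite} mat2 \<Rightarrow> 'a mat2 \<Rightarrow> 'a mat2" where
  "Ad g A = g ** A ** matrix_inv g"

text \<open>\<open>N(F)\<close> for the Borel subgroups \<open>B\<^sub>0\<close> (upper triangular) and its opposite.\<close>

definition N_upper :: "'a::{field,finite} mat2 set" where
  "N_upper = {u. u $ 1 $ 1 = 1 \<and> u $ 2 $ 2 = 1 \<and> u $ 2 $ 1 = 0}"

definition N_lower :: "'a::{field,finite} mat2 set" where
  "N_lower = {u. u $ 1 $ 1 = 1 \<and> u $ 2 $ 2 = 1 \<and> u $ 1 $ 2 = 0}"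


section \<open>The maps \<open>H\<^sub>B\<close> and the segments \<open>Ec(g)\<close>\<close>

text \<open>\<open>\<aa>\<^sub>T = \<real>\<^sup>2\<close>; the Borel subgroup \<open>B = TN\<close> enters through \<open>N\<close>.\<close>

definition H_map :: "'a::{field,finite} mat2 set \<Rightarrow> 'a mat2 \<Rightarrow> real ^ 2" where
  "H_map N g = (THE v. \<exists>u \<in> N. \<exists>t \<in> torus_F. \<exists>k \<in> GL2_O.
      g = u ** t ** k \<and> v = (\<chi> i. of_int (fls_subdegree (t $ i $ i))))"

definition coroot12 :: "real ^ 2" where
  "coroot12 = vector [1, -1]"

definition Ec :: "'a::{field,finite} mat2 \<Rightarrow> (real ^ 2) set" where
  "Ec g = closed_segment (H_map N_upper g) (H_map N_lower g)"

definition n_of :: "'a::{field,finite} mat2 \<Rightarrow> int" where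
  "n_of g = (THE m. H_map N_upper g - H_map N_lower g = of_int m *\<^sub>R coroot12)"


section \<open>Affine Grassmannian, affine Springer fibre and its truncations\<close>

definition coset_K :: "'a::{field,finite} mat2 \<Rightarrow> 'a mat2 set" where
  "coset_K g = (\<lambda>k. g ** k) ` GL2_O"

text \<open>
  All conditions on \<open>g\<close> below depend only on the coset \<open>gK\<close>.  The sets of cosets are the sets of
  \<open>\<bbbF>\<^sub>q\<close>-points of the corresponding varieties.
\<close>

definition springer_fibre :: "'a::{field,finite} mat2 \<Rightarrow> 'a mat2 set set" where
  "springer_fibre \<gamma> = {coset_K g | g. g \<in> GL2_F \<and> Ad (matrix_inv g) \<gamma> \<in> gl2_int}"

definition springer_fibre0 :: "'a::{field,finite} mat2 \<Rightarrow> 'a mat2 set set" where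
  "springer_fibre0 \<gamma> = {coset_K g | g. g \<in> GL2_F \<and> coset_K g \<in> springer_fibre \<gamma> \<and>
      fls_subdegree (det g) = 0}"

definition springer_fibre0_trunc ::
    "'a::{field,finite} mat2 \<Rightarrow> (real ^ 2) set \<Rightarrow> 'a mat2 set set" where
  "springer_fibre0_trunc \<gamma> S = {coset_K g | g. g \<in> GL2_F \<and> coset_K g \<in> springer_fibre0 \<gamma> \<and>
      Ec g \<subseteq> S}"

text \<open>The point \<open>[g]\<close> is regular if \<open>n_of\<close> attains its maximum on the fibre there.\<close>

definition regular_point :: "'a::{field,finite} mat2 \<Rightarrow> 'a mat2 \<Rightarrow> bool" where
  "regular_point \<gamma> g \<longleftrightarrow> g \<in> GL2_F \<and> coset_K g \<in> springer_fibre \<gamma> \<and>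
     (\<forall>h \<in> GL2_F. coset_K h \<in> springer_fibre \<gamma> \<longrightarrow> n_of h \<le> n_of g)"

definition weyl :: "(2 \<Rightarrow> 2) set" where
  "weyl = {w. w permutes UNIV}"

definition weyl_s :: "2 \<Rightarrow> 2" where
  "weyl_s = Transposition.transpose 1 2"

definition weyl_act :: "(2 \<Rightarrow> 2) \<Rightarrow> real ^ 2 \<Rightarrow> real ^ 2" where
  "weyl_act w v = (\<chi> i. v $ (inv w i))"

text \<open>Families indexed by \<open>weyl = {id, weyl_s}\<close>; the value outside \<open>weyl\<close> is irrelevant.\<close>

definition Sigma_vertex :: "'a::{field,finite} mat2 \<Rightarrow> (2 \<Rightarrow> 2) \<Rightarrow> real ^ 2" where
  "Sigma_vertex g w = (if w = id then H_map N_upper g else H_map N_lower g)"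

definition Pi_vertex :: "'a::{field,finite} mat2 \<Rightarrow> nat \<Rightarrow> (2 \<Rightarrow> 2) \<Rightarrow> real ^ 2" where
  "Pi_vertex g a w = Sigma_vertex g w + weyl_act w (real a *\<^sub>R coroot12)"

definition family_segment :: "((2 \<Rightarrow> 2) \<Rightarrow> real ^ 2) \<Rightarrow> (real ^ 2) set" where
  "family_segment L = closed_segment (L id) (L weyl_s)"


section \<open>The line \<open>\<aa>\<^sub>T\<^sup>G\<close>\<close>

definition aTG :: "(real ^ 2) set" where
  "aTG = {v. v $ 1 + v $ 2 = 0}"

definition weyl_inner_product :: "(real ^ 2 \<Rightarrow> real ^ 2 \<Rightarrow> real) \<Rightarrow> bool" where
  "weyl_inner_product ip \<longleftrightarrow>
     (\<forall>x \<in> aTG. \<forall>y \<in> aTG. \<forall>z \<in> aTG. ip (x + y) z = ip x z + ip y z) \<and>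
     (\<forall>x \<in> aTG. \<forall>y \<in> aTG. \<forall>r. ip (r *\<^sub>R x) y = r * ip x y) \<and>
     (\<forall>x \<in> aTG. \<forall>y \<in> aTG. ip x y = ip y x) \<and>
     (\<forall>x \<in> aTG. x \<noteq> 0 \<longrightarrow> ip x x > 0) \<and>
     (\<forall>w \<in> weyl. \<forall>x \<in> aTG. \<forall>y \<in> aTG. ip (weyl_act w x) (weyl_act w y) = ip x y)"

text \<open>
  The Lebesgue measure on \<open>\<aa>\<^sub>T\<^sup>G\<close> giving covolume 1 to \<open>\<int>u\<close>, \<open>u\<close> a unit vector; the two unit
  vectors \<open>\<plusminus>u\<close> give the same measure.
\<close>

definition unit_aTG :: "(real ^ 2 \<Rightarrow> real ^ 2 \<Rightarrow> real) \<Rightarrow> real ^ 2" where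
  "unit_aTG ip = (SOME u. u \<in> aTG \<and> ip u u = 1)"

definition leb_aTG :: "(real ^ 2 \<Rightarrow> real ^ 2 \<Rightarrow> real) \<Rightarrow> (real ^ 2) measure" where
  "leb_aTG ip = distr lborel (restrict_space borel aTG) (\<lambda>r. r *\<^sub>R unit_aTG ip)"

definition proj_aTG :: "real ^ 2 \<Rightarrow> real ^ 2" where
  "proj_aTG v = vector [(v $ 1 - v $ 2) / 2, (v $ 2 - v $ 1) / 2]"

definition cochar_SL2 :: "(real ^ 2) set" where
  "cochar_SL2 = {v. v $ 1 \<in> \<int> \<and> v $ 2 \<in> \<int> \<and> v $ 1 + v $ 2 = 0}"

text \<open>\<open>vol(\<aa>\<^sub>T\<^sup>G / L)\<close> for a lattice \<open>L = \<int>b\<close>, as the volume of the half-open cell of \<open>b\<close>.\<close>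

definition covolume :: "(real ^ 2 \<Rightarrow> real ^ 2 \<Rightarrow> real) \<Rightarrow> (real ^ 2) set \<Rightarrow> real" where
  "covolume ip L = (let b = (SOME b. L = {of_int m *\<^sub>R b | m. True})
     in measure (leb_aTG ip) {r *\<^sub>R b | r. 0 \<le> r \<and> r < 1})"

definition v_T :: "(real ^ 2 \<Rightarrow> real ^ 2 \<Rightarrow> real) \<Rightarrow> 'a::{field,finite} mat2 \<Rightarrow> real" where
  "v_T ip g = measure (leb_aTG ip) (proj_aTG ` Ec g)"


section \<open>Haar measures and orbital integrals\<close>

text \<open>
  For \<open>H\<close> a locally closed subgroup of \<open>GL\<^sub>2(F)\<close>.  Such \<open>H\<close> is second countable, so a Borel measure
  that is finite on compact sets is a Radon measure.  The measure is left invariant; for the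
  unimodular groups \<open>GL2_F\<close> and \<open>torus_F\<close> it is then also right invariant.
\<close>

definition haar_measure :: "'a::{field,finite} mat2 set \<Rightarrow> 'a mat2 measure \<Rightarrow> bool" where
  "haar_measure H M \<longleftrightarrow>
     space M = H \<and> sets M = sets (restrict_space borel H) \<and>
     (\<forall>h \<in> H. \<forall>A \<in> sets M. emeasure M ((\<lambda>x. h ** x) ` A) = emeasure M A) \<and>
     (\<forall>C. compact C \<and> C \<subseteq> H \<longrightarrow> emeasure M C < \<infinity>) \<and>
     emeasure M H \<noteq> 0"

definition coset_T :: "'a::{field,finite} mat2 \<Rightarrow> 'a mat2 set" where
  "coset_T g = (\<lambda>t. t ** g) ` torus_F"

definition coset_rep :: "'a::{field,finite} mat2 set \<Rightarrow> 'a mat2" where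
  "coset_rep c = (SOME g. g \<in> c)"

text \<open>
  \<open>Q\<close> is the quotient measure \<open>dg/dt\<close> on \<open>T(F)\G(F)\<close>, characterised by
  \<open>\<integral>\<^sub>G f(g) dg = \<integral>\<^bsub>T\G\<^esub> \<integral>\<^sub>T f(tg) dt\<close>.  Its measurable sets are those with Borel preimage in \<open>G(F)\<close>,
  which are the Borel sets of the quotient topology.  The inner integral does not depend on the
  representative because \<open>dt\<close> is invariant.
\<close>

definition quotient_measure ::
    "'a::{field,finite} mat2 measure \<Rightarrow> 'a mat2 measure \<Rightarrow> 'a mat2 set measure \<Rightarrow> bool" where
  "quotient_measure dg dt Q \<longleftrightarrow>
     space Q = coset_T ` GL2_F \<and>
     sets Q = {S. S \<subseteq> coset_T ` GL2_F \<and> \<Union>S \<in> sets dg} \<and>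
     (\<forall>f :: 'a mat2 \<Rightarrow> ennreal. f \<in> borel_measurable dg \<longrightarrow>
        (\<integral>\<^sup>+ g. f g \<partial>dg) = (\<integral>\<^sup>+ c. (\<integral>\<^sup>+ t. f (t ** coset_rep c) \<partial>dt) \<partial>Q))"

text \<open>The integrands are left \<open>T(F)\<close>-invariant, so the choice of representatives is immaterial.\<close>

definition orbital_integral :: "'a::{field,finite} mat2 set measure \<Rightarrow> 'a mat2 \<Rightarrow> real" where
  "orbital_integral Q \<gamma> = (LINT c|Q. indicat_real gl2_int (Ad (matrix_inv (coset_rep c)) \<gamma>))"

definition weighted_orbital_integral ::
    "(real ^ 2 \<Rightarrow> real ^ 2 \<Rightarrow> real) \<Rightarrow> 'a::{field,finite} mat2 set measure \<Rightarrow> 'a mat2 \<Rightarrow> real" where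
  "weighted_orbital_integral ip Q \<gamma> =
     (LINT c|Q. indicat_real gl2_int (Ad (matrix_inv (coset_rep c)) \<gamma>) * v_T ip (coset_rep c))"

end

(*
  By the Iwasawa decomposition every g in GL_2(F) is t u(y) k with t in T(F), k in K and
  u(y) = (1 y; 0 1).  Only the pole order m of y matters: n_of g = m, the segment Ec(g) is m times
  the coroot, and Ad(g^-1) gamma is integral iff m <= n.  The set of all u(y) K with m(y) <= j is a
  disjoint union of q^j cosets of K.  Testing the quotient measure on its indicator function, whose
  integral along each T(F)-orbit that it meets is vol(T(O)) = 1, shows that {m <= j} has measure q^j
  in T(F)\G(F); hence the orbital integral is q^n and the weighted one is proportional to
  sum_{j<n} (q^n - q^j).  The points of the truncated fibre are the classes of
  diag(eps^k, eps^-k) u(r), r a principal part of pole order at most n, with k ranging over an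
  interval of 2a + n + 1 - m(r) integers.
*)

theory Submission
  imports Defs
begin

(* The symbol would otherwise be ambiguous with the components of vectors. *)
no_notation fps_nth (infixl "$" 75)

section \<open>Matrices over the local field\<close>

text \<open>The quotient measure is known only through its integration formula, so measuring a set
  of T(F)-orbits takes a test function on G(F) whose orbit integrals form an indicator function. The
  set of all u(y) k with m(y) <= j supplies one: t u(y) k lies in it only if t is in T(O).
  Measurability rests on one observation: K contains 1 + eps gl_2(O), hence every right K-invariant
  subset of G(F) is open. Both sums of powers of q come from layering. For m <= n the weight m is
  the number of j < n with j < m, which writes it as a sum of differences of level sets; likewise n
  + 1 - m(r) is the number of j with m(r) <= j <= n, so the count over r becomes a sum of q^j. The
  term 2a appears because the family extends the segment of the regular point by a coroots at either
  end. The proportionality factor is the covolume because the coroot generates the cocharacter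
  lattice of the torus of SL_2.\<close>

lemma integers_iff: "x \<in> integers \<longleftrightarrow> 0 \<le> fls_subdegree x"
proof
  assume "0 \<le> fls_subdegree x"
  then have "x = fps_to_fls (fls_regpart x)" by simp
  then show "x \<in> integers" unfolding integers_def by blast
qed (auto simp: integers_def fls_subdegree_fls_to_fps_gt0)

lemma integers_0 [simp]: "0 \<in> integers" and integers_1 [simp]: "1 \<in> integers"
  by (simp_all add: integers_iff)

lemma integers_uminus [simp]: "- x \<in> integers \<longleftrightarrow> x \<in> integers"
  by (simp add: integers_iff)

lemma integers_mult: "x \<in> integers \<Longrightarrow> y \<in> integers \<Longrightarrow> x * y \<in> integers"
  by (cases "x = 0 \<or> y = 0") (auto simp: integers_iff)

lemma integers_add: "x \<in> integers \<Longrightarrow> y \<in> integers \<Longrightarrow> x + y \<in> integers"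
  unfolding integers_iff using fls_plus_subdegree[of x y] by (cases "x + y = 0") auto

lemma integers_diff: "x \<in> integers \<Longrightarrow> y \<in> integers \<Longrightarrow> x - y \<in> integers"
  using integers_add[of x "- y"] by simp

section \<open>Two-by-two matrices given by their entries\<close>

definition mat22 :: "'b::zero \<Rightarrow> 'b \<Rightarrow> 'b \<Rightarrow> 'b \<Rightarrow> 'b ^ 2 ^ 2" where
  "mat22 a b c d = vector [vector [a, b], vector [c, d]]"

lemma mat22_nth [simp]:
  "mat22 a b c d $ 1 $ 1 = a" "mat22 a b c d $ 1 $ 2 = b"
  "mat22 a b c d $ 2 $ 1 = c" "mat22 a b c d $ 2 $ 2 = d"
  by (simp_all add: mat22_def)

lemma mat22_eq_iff:
  "A = B \<longleftrightarrow> A $ 1 $ 1 = B $ 1 $ 1 \<and> A $ 1 $ 2 = B $ 1 $ 2 \<and> A $ 2 $ 1 = B $ 2 $ 1 \<and> A $ 2 $ 2 = B $ 2 $ 2"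
  for A :: "'b ^ 2 ^ 2"
  by (auto simp: vec_eq_iff forall_2)

lemma mat22_mult:
  "mat22 a b c d ** mat22 a' b' c' d' =
     mat22 (a * a' + b * c') (a * b' + b * d') (c * a' + d * c') (c * b' + d * (d' :: 'b::semiring_1))"
  by (simp add: mat22_eq_iff matrix_matrix_mult_def sum_2)

lemma mult_nth_2: "(A ** B) $ i $ j = A $ i $ 1 * B $ 1 $ j + A $ i $ 2 * B $ 2 $ j"
  for A B :: "'b::semiring_1 ^ 2 ^ 2"
  by (simp add: matrix_matrix_mult_def sum_2)

lemma mat_1_eq_mat22: "mat 1 = mat22 1 0 0 (1 :: 'b::zero_neq_one)"
  by (simp add: mat22_eq_iff mat_def)

lemma det_mat22: "det (mat22 a b c d) = a * d - b * (c :: 'b::comm_ring_1)"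
  by (simp add: det_2)

text \<open>\<open>matrix_inv\<close> is a Hilbert choice: \<open>B\<close> shows that a two-sided
  inverse exists, so the chosen matrix is one, and associativity identifies it with
  \<open>B\<close>.\<close>

lemma matrix_inv_unique:
  assumes "A ** B = mat 1" "B ** A = mat 1"
  shows "matrix_inv A = (B :: 'b::semiring_1 ^ 'n ^ 'n)"
proof -
  have *: "A ** matrix_inv A = mat 1 \<and> matrix_inv A ** A = mat 1"
    unfolding matrix_inv_def by (rule someI[of _ B]) (use assms in auto)
  have "matrix_inv A = (B ** A) ** matrix_inv A" using assms by simp
  also have "\<dots> = B ** (A ** matrix_inv A)" by (simp add: matrix_mul_assoc)
  finally show ?thesis using * by simp
qed

lemma GL2_F_iff: "g \<in> GL2_F \<longleftrightarrow> det g \<noteq> 0"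
  by (simp add: GL2_F_def invertible_det_nz)

lemma matrix_inv_GL2:
  assumes "g \<in> GL2_F"
  shows "g ** matrix_inv g = mat 1" "matrix_inv g ** g = mat 1"
  using assms matrix_inv_unique[of g] by (auto simp: GL2_F_def invertible_def)

lemma matrix_inv_matrix_inv: "g \<in> GL2_F \<Longrightarrow> matrix_inv (matrix_inv g) = g"
  by (rule matrix_inv_unique) (simp_all add: matrix_inv_GL2)

lemma GL2_F_mult: "g \<in> GL2_F \<Longrightarrow> h \<in> GL2_F \<Longrightarrow> g ** h \<in> GL2_F"
  by (simp add: GL2_F_iff det_mul)

lemma matrix_inv_mult:
  assumes "g \<in> GL2_F" "h \<in> GL2_F"
  shows "matrix_inv (g ** h) = matrix_inv h ** matrix_inv g"
proof (rule matrix_inv_unique)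
  have "g ** h ** (matrix_inv h ** matrix_inv g) = g ** (h ** matrix_inv h) ** matrix_inv g"
    by (simp only: matrix_mul_assoc)
  then show "g ** h ** (matrix_inv h ** matrix_inv g) = mat 1"
    using assms by (simp add: matrix_inv_GL2)
  have "matrix_inv h ** matrix_inv g ** (g ** h) = matrix_inv h ** (matrix_inv g ** g) ** h"
    by (simp only: matrix_mul_assoc)
  then show "matrix_inv h ** matrix_inv g ** (g ** h) = mat 1"
    using assms by (simp add: matrix_inv_GL2)
qed

lemma matrix_inv_mat22:
  assumes "a * d - b * c \<noteq> (0 :: 'b::field)"
  shows "matrix_inv (mat22 a b c d) =
    mat22 (d / (a * d - b * c)) (- b / (a * d - b * c)) (- c / (a * d - b * c)) (a / (a * d - b * c))"
  by (rule matrix_inv_unique)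
    (use assms in \<open>auto simp: mat22_mult mat_1_eq_mat22 mat22_eq_iff diff_divide_distrib[symmetric]
        add_divide_distrib[symmetric] mult.commute\<close>)

section \<open>Integral matrices, the group K and its cosets\<close>

lemma gl2_int_iff:
  "A \<in> gl2_int \<longleftrightarrow> A $ 1 $ 1 \<in> integers \<and> A $ 1 $ 2 \<in> integers \<and> A $ 2 $ 1 \<in> integers \<and> A $ 2 $ 2 \<in> integers"
  by (auto simp: gl2_int_def forall_2)

lemma gl2_int_mult: "A \<in> gl2_int \<Longrightarrow> B \<in> gl2_int \<Longrightarrow> A ** B \<in> gl2_int"
  by (simp add: gl2_int_iff mult_nth_2 integers_add integers_mult)

lemma gl2_int_det: "A \<in> gl2_int \<Longrightarrow> det A \<in> integers"
  by (simp add: gl2_int_iff det_2 integers_diff integers_mult)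

text \<open>The determinants of two mutually inverse integral matrices have nonnegative valuations
  with sum 0. Conversely, the adjugate divided by a determinant of valuation 0 is integral.
  Nonvanishing is a separate clause because the zero series has subdegree 0 as well.\<close>

lemma GL2_O_iff: "k \<in> GL2_O \<longleftrightarrow> k \<in> gl2_int \<and> det k \<noteq> 0 \<and> fls_subdegree (det k) = 0"
proof
  assume "k \<in> GL2_O"
  then obtain k' where k: "k \<in> gl2_int" "k' \<in> gl2_int" "k ** k' = mat 1"
    by (auto simp: GL2_O_def)
  then have d: "det k * det k' = 1" by (metis det_mul det_I)
  then have nz: "det k \<noteq> 0" "det k' \<noteq> 0" by auto
  with d have "fls_subdegree (det k) + fls_subdegree (det k') = 0"
    by (metis fls_subdegree_mult fls_one_subdegree)
  with gl2_int_det[OF k(1)] gl2_int_det[OF k(2)] k nz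
  show "k \<in> gl2_int \<and> det k \<noteq> 0 \<and> fls_subdegree (det k) = 0"
    by (auto simp: integers_iff)
next
  assume k: "k \<in> gl2_int \<and> det k \<noteq> 0 \<and> fls_subdegree (det k) = 0"
  obtain a b c d where keq: "k = mat22 a b c d"
    by (metis mat22_eq_iff mat22_nth)
  have i: "inverse (det k) \<in> integers"
    using k by (simp add: integers_iff fls_inverse_subdegree)
  have div: "x / (a * d - b * c) \<in> integers" if "x \<in> integers" for x
    using integers_mult[OF that i] by (simp add: keq det_mat22 field_simps)
  have "matrix_inv k \<in> gl2_int"
    using k matrix_inv_mat22[of a d b c] div
    by (auto simp: keq det_mat22 gl2_int_iff intro!: div)
  moreover have "k \<in> GL2_F" using k by (simp add: GL2_F_iff)
  ultimately show "k \<in> GL2_O"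
    using k matrix_inv_GL2 by (auto simp: GL2_O_def)
qed

lemma GL2_O_imp_GL2_F: "k \<in> GL2_O \<Longrightarrow> k \<in> GL2_F"
  by (simp add: GL2_O_iff GL2_F_iff)

lemma GL2_O_mult: "k \<in> GL2_O \<Longrightarrow> l \<in> GL2_O \<Longrightarrow> k ** l \<in> GL2_O"
  by (simp add: GL2_O_iff gl2_int_mult det_mul)

lemma GL2_O_matrix_inv:
  assumes "k \<in> GL2_O" shows "matrix_inv k \<in> GL2_O"
proof -
  from assms obtain k' where "k \<in> gl2_int" "k' \<in> gl2_int" "k ** k' = mat 1" "k' ** k = mat 1"
    by (auto simp: GL2_O_def)
  with matrix_inv_unique[of k k'] show ?thesis by (auto simp: GL2_O_def)
qed

lemma mat_1_GL2_O [simp]: "mat 1 \<in> GL2_O"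
  by (simp add: mat_1_eq_mat22 GL2_O_iff gl2_int_iff det_mat22)

lemma coset_K_eq_iff:
  assumes "g \<in> GL2_F"
  shows "coset_K g = coset_K h \<longleftrightarrow> (\<exists>k \<in> GL2_O. h = g ** k)"
proof
  assume "coset_K g = coset_K h"
  moreover have "h \<in> coset_K h"
    unfolding coset_K_def by (rule image_eqI[of _ _ "mat 1"]) auto
  ultimately show "\<exists>k \<in> GL2_O. h = g ** k" by (auto simp: coset_K_def)
next
  assume "\<exists>k \<in> GL2_O. h = g ** k"
  then obtain k where k: "k \<in> GL2_O" "h = g ** k" by blast
  have "g ** l \<in> coset_K h" if "l \<in> GL2_O" for l
  proof -
    have "g ** l = g ** (k ** matrix_inv k) ** l"
      using k by (simp add: matrix_inv_GL2 GL2_O_imp_GL2_F)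
    also have "\<dots> = h ** (matrix_inv k ** l)" by (simp add: k matrix_mul_assoc)
    finally show ?thesis using that k by (auto simp: coset_K_def GL2_O_mult GL2_O_matrix_inv)
  qed
  moreover have "h ** l \<in> coset_K g" if "l \<in> GL2_O" for l
    using that k by (auto simp: coset_K_def GL2_O_mult simp flip: matrix_mul_assoc)
  ultimately show "coset_K g = coset_K h" by (auto simp: coset_K_def)
qed

section \<open>Torus elements, unipotents and pole orders\<close>

definition torus_elt :: "'a::{field,finite} fls \<Rightarrow> 'a fls \<Rightarrow> 'a mat2" where
  "torus_elt a b = mat22 a 0 0 b"

definition unip :: "'a::{field,finite} fls \<Rightarrow> 'a mat2" where
  "unip y = mat22 1 y 0 1"

text \<open>Truncation by \<open>nat\<close> gives all integral series, 0 included, pole order 0;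
  this makes the pole order constant on classes modulo the integers.\<close>

definition pole :: "'a::zero fls \<Rightarrow> nat" where
  "pole y = nat (- fls_subdegree y)"

lemma pole_le_iff: "pole y \<le> m \<longleftrightarrow> - int m \<le> fls_subdegree y"
  by (auto simp: pole_def)

lemma pole_unit_mult:
  fixes y :: "'a::{field,finite} fls"
  assumes "u \<noteq> 0" "fls_subdegree u = 0" shows "pole (u * y) = pole y"
  using assms by (cases "y = 0") (auto simp: pole_def)

text \<open>One inequality suffices: applied to \<open>x\<close>, and then to \<open>- x\<close>,
  which undoes the addition.\<close>

lemma pole_add_integer:
  assumes "x \<in> integers" shows "pole (y + x) = pole y"
proof -
  have ge: "- int (pole z) \<le> fls_subdegree z" for z :: "'a fls"
    using pole_le_iff by blast
  have *: "pole (y + x) \<le> pole y" if "x \<in> integers" for x y :: "'a fls"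
  proof (cases "y + x = 0")
    case False
    have "min (fls_subdegree y) (fls_subdegree x) \<le> fls_subdegree (y + x)"
      using False by (rule fls_plus_subdegree)
    moreover have "0 \<le> fls_subdegree x" using that by (simp add: integers_iff)
    ultimately show ?thesis by (auto simp: pole_def)
  qed (simp add: pole_def)
  from *[of x y] *[of "- x" "y + x"] assms show ?thesis by simp
qed

lemma torus_elt_F: "torus_elt a b \<in> torus_F \<longleftrightarrow> a \<noteq> 0 \<and> b \<noteq> 0"
  by (simp add: torus_elt_def torus_F_def GL2_F_iff det_mat22)

lemma torus_F_cases:
  assumes "t \<in> torus_F"
  obtains a b where "a \<noteq> 0" "b \<noteq> 0" "t = torus_elt a b"
proof -
  have "t = torus_elt (t $ 1 $ 1) (t $ 2 $ 2)"
    using assms by (simp add: torus_F_def torus_elt_def mat22_eq_iff)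
  then show thesis using assms that torus_elt_F by metis
qed

text \<open>An integral column operation clears the bottom row \<open>(r, s)\<close>: the entry of
  smaller valuation serves as pivot, so the quotient is integral. The pivot becomes the lower torus
  entry; the determinant over the pivot, up to the sign of a column swap, becomes the upper
  one.\<close>

lemma iwasawa:
  fixes g :: "'a::{field,finite} mat2"
  assumes "g \<in> GL2_F"
  obtains a b y k where "a \<noteq> 0" "b \<noteq> 0" "k \<in> GL2_O" "g = torus_elt a b ** unip y ** k"
proof -
  obtain p q r s where g: "g = mat22 p q r s" by (metis mat22_eq_iff mat22_nth)
  have det: "p * s - q * r \<noteq> 0" using assms by (simp add: g GL2_F_iff det_mat22)
  show thesis
  \<comment> \<open>Without \<open>s \<noteq> 0\<close> the value \<open>r / 0 = 0\<close> would
    count as integral.\<close>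
  proof (cases "s \<noteq> 0 \<and> r / s \<in> integers")
    case True
    define \<Delta> where "\<Delta> = p * s - q * r"
    have "mat22 1 0 (r / s) 1 \<in> GL2_O"
      using True by (simp add: GL2_O_iff gl2_int_iff det_mat22)
    moreover have "g = torus_elt (\<Delta> / s) s ** unip (q * s / \<Delta>) ** mat22 1 0 (r / s) 1"
      using True det by (simp add: g torus_elt_def unip_def mat22_mult mat22_eq_iff \<Delta>_def field_simps)
    ultimately show thesis using True det that[of "\<Delta> / s" s] by (simp add: \<Delta>_def)
  next
    case False
    then have r: "r \<noteq> 0" using det by auto
    with False have sr: "s / r \<in> integers"
      by (cases "s = 0") (auto simp: integers_iff fls_divide_subdegree)
    define \<Delta> where "\<Delta> = q * r - p * s"
    have "mat22 0 1 1 (s / r) \<in> GL2_O"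
      using sr by (simp add: GL2_O_iff gl2_int_iff det_mat22)
    moreover have "g = torus_elt (\<Delta> / r) r ** unip (p * r / \<Delta>) ** mat22 0 1 1 (s / r)"
      using r det by (simp add: g torus_elt_def unip_def mat22_mult mat22_eq_iff \<Delta>_def field_simps)
    ultimately show thesis using r det that[of "\<Delta> / r" r] by (simp add: \<Delta>_def)
  qed
qed

section \<open>Iwasawa decomposition and the maps \<open>H\<^sub>B\<close>\<close>

lemma torus_elt_mult: "torus_elt a b ** torus_elt c d = torus_elt (a * c) (b * d)"
  by (simp add: torus_elt_def mat22_mult)

lemma unip_mult: "unip x ** unip y = unip (x + y)"
  by (simp add: unip_def mat22_mult add.commute)

lemma unip_torus_elt: "a \<noteq> 0 \<Longrightarrow> unip y ** torus_elt a b = torus_elt a b ** unip (b / a * y)"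
  by (simp add: unip_def torus_elt_def mat22_mult mult.commute)

lemma det_torus_elt: "det (torus_elt a b) = a * b"
  by (simp add: torus_elt_def det_mat22)

lemma det_unip: "det (unip y) = 1"
  by (simp add: unip_def det_mat22)

lemma torus_elt_GL2_F [simp]: "torus_elt a b \<in> GL2_F \<longleftrightarrow> a \<noteq> 0 \<and> b \<noteq> 0"
  by (simp add: GL2_F_iff det_torus_elt)

lemma unip_GL2_F [simp]: "unip y \<in> GL2_F"
  by (simp add: GL2_F_iff det_unip)

lemma unip_GL2_O: "unip y \<in> GL2_O \<longleftrightarrow> y \<in> integers"
  by (simp add: GL2_O_iff gl2_int_iff det_unip) (simp add: unip_def)

lemma torus_elt_GL2_O:
  "torus_elt a b \<in> GL2_O \<longleftrightarrow> a \<noteq> 0 \<and> b \<noteq> 0 \<and> fls_subdegree a = 0 \<and> fls_subdegree b = 0"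
  by (cases "a = 0 \<or> b = 0")
    (auto simp: GL2_O_iff gl2_int_iff det_torus_elt, auto simp: torus_elt_def integers_iff)

lemma matrix_inv_torus_elt:
  "a \<noteq> 0 \<Longrightarrow> b \<noteq> 0 \<Longrightarrow> matrix_inv (torus_elt a b) = torus_elt (inverse a) (inverse b)"
  by (rule matrix_inv_unique) (simp_all add: torus_elt_def mat22_mult mat_1_eq_mat22)

lemma matrix_inv_unip: "matrix_inv (unip y) = unip (- y)"
  by (rule matrix_inv_unique) (simp_all add: unip_def mat22_mult mat_1_eq_mat22)

text \<open>The two diagonal valuations are nonnegative and add up to that of the determinant, which
  is 0.\<close>

lemma triangular_GL2_O_subdegree:
  assumes "l \<in> GL2_O" "l $ 1 $ 2 = 0 \<or> l $ 2 $ 1 = 0"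
  shows "l $ i $ i \<noteq> 0" "fls_subdegree (l $ i $ i) = 0"
proof -
  have d: "det l = l $ 1 $ 1 * l $ 2 $ 2" using assms(2) by (auto simp: det_2)
  then have nz: "l $ 1 $ 1 \<noteq> 0" "l $ 2 $ 2 \<noteq> 0" using assms(1) by (auto simp: GL2_O_iff)
  then have "fls_subdegree (l $ 1 $ 1) + fls_subdegree (l $ 2 $ 2) = 0"
    using assms(1) d by (simp add: GL2_O_iff)
  then show "l $ i $ i \<noteq> 0" "fls_subdegree (l $ i $ i) = 0"
    using nz assms(1) exhaust_2[of i] by (auto simp: GL2_O_iff gl2_int_iff integers_iff)
qed

text \<open>This justifies the definite description in \<open>H_map\<close>. Two decompositions of
  \<open>g\<close> differ by an element \<open>l\<close> of K that also lies in the Borel subgroup;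
  it is triangular with units on the diagonal, so the torus parts have equal valuations.\<close>

lemma H_map_eq:
  assumes N: "N = N_upper \<or> N = N_lower"
    and u: "u \<in> N" and t: "t \<in> torus_F" and k: "k \<in> GL2_O" and g: "g = u ** t ** k"
  shows "H_map N g = (\<chi> i. of_int (fls_subdegree (t $ i $ i)))"
  unfolding H_map_def
proof (rule the_equality)
  fix v assume "\<exists>u \<in> N. \<exists>t \<in> torus_F. \<exists>k \<in> GL2_O. g = u ** t ** k \<and>
      v = (\<chi> i. of_int (fls_subdegree (t $ i $ i)))"
  then obtain u' t' k' where *: "u' \<in> N" "t' \<in> torus_F" "k' \<in> GL2_O" "g = u' ** t' ** k'"
    and v: "v = (\<chi> i. of_int (fls_subdegree (t' $ i $ i)))" by blast
  define l where "l = k' ** matrix_inv k"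
  have l: "l \<in> GL2_O" using * k by (simp add: l_def GL2_O_mult GL2_O_matrix_inv)
  have "u ** t = u ** t ** (k ** matrix_inv k)"
    using k by (simp add: matrix_inv_GL2 GL2_O_imp_GL2_F)
  also have "\<dots> = u' ** t' ** l"
    using g * by (simp add: l_def matrix_mul_assoc)
  finally have eq: "(u ** t) $ i $ j = (u' ** t' ** l) $ i $ j" for i j by simp
  have nz: "t $ i $ i \<noteq> 0" "t' $ i $ i \<noteq> 0" for i
    using t * exhaust_2[of i] by (auto simp: torus_F_def GL2_F_iff det_2)
  have "l $ 1 $ 2 = 0 \<or> l $ 2 $ 1 = 0"
    using N u t * nz eq[of 1 2] eq[of 2 1]
    by (auto simp: torus_F_def N_upper_def N_lower_def mult_nth_2)
  note lu = triangular_GL2_O_subdegree[OF l this]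
  have "t $ i $ i = t' $ i $ i * l $ i $ i" for i
    using N u t * nz eq[of 1 1] eq[of 2 2] eq[of 1 2] eq[of 2 1] exhaust_2[of i]
    by (auto simp: torus_F_def N_upper_def N_lower_def mult_nth_2)
  then have "fls_subdegree (t $ i $ i) = fls_subdegree (t' $ i $ i)" for i
    using lu[of i] nz[of i] by simp
  then show "v = (\<chi> i. of_int (fls_subdegree (t $ i $ i)))" by (simp add: v)
qed (use assms in blast)

lemma unip_GL2_O_iff_pole: "unip y \<in> GL2_O \<longleftrightarrow> pole y = 0"
  by (simp add: unip_GL2_O integers_iff pole_def)

context
  fixes a b y :: "'a::{field,finite} fls" and k :: "'a mat2"
  assumes ab: "a \<noteq> 0" "b \<noteq> 0" and k: "k \<in> GL2_O"
begin

text \<open>\<open>iwasawa\<close> puts the torus on the left, \<open>H_map\<close> the unipotent;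
  commuting them rescales \<open>y\<close> and keeps the torus part.\<close>

lemma H_map_upper:
  "H_map N_upper (torus_elt a b ** unip y ** k) =
    vector [of_int (fls_subdegree a), of_int (fls_subdegree b)]"
proof -
  have "torus_elt a b ** unip y = unip (a * y / b) ** torus_elt a b"
    using ab by (simp add: unip_torus_elt)
  moreover have "unip (a * y / b) \<in> N_upper" by (simp add: unip_def N_upper_def)
  ultimately have "H_map N_upper (torus_elt a b ** unip y ** k) =
      (\<chi> i. of_int (fls_subdegree (torus_elt a b $ i $ i)))"
    using ab k by (intro H_map_eq) (auto simp: torus_elt_F)
  then show ?thesis by (simp add: vec_eq_iff forall_2 torus_elt_def)
qed

text \<open>If \<open>y\<close> is integral, \<open>unip y\<close> is absorbed into K. Otherwise it
  factors as a lower unipotent with entry \<open>1 / y\<close>, the torus element with entries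
  \<open>y\<close> and \<open>1 / y\<close>, and an element of K; the torus element shifts the
  valuations by the pole order.\<close>

lemma H_map_lower:
  "H_map N_lower (torus_elt a b ** unip y ** k) =
    vector [of_int (fls_subdegree a) - real (pole y), of_int (fls_subdegree b) + real (pole y)]"
proof (cases "pole y = 0")
  case True
  have "H_map N_lower (torus_elt a b ** unip y ** k) =
      (\<chi> i. of_int (fls_subdegree (torus_elt a b $ i $ i)))"
  proof (rule H_map_eq)
    show "torus_elt a b ** unip y ** k = mat 1 ** torus_elt a b ** (unip y ** k)"
      by (simp add: matrix_mul_assoc)
    show "unip y ** k \<in> GL2_O" using True k by (simp add: GL2_O_mult unip_GL2_O_iff_pole)
  qed (use ab in \<open>auto simp: torus_elt_F N_lower_def mat_def\<close>)
  then show ?thesis by (simp add: vec_eq_iff forall_2 torus_elt_def True)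
next
  case False
  then have y: "y \<noteq> 0" "fls_subdegree y = - int (pole y)" by (auto simp: pole_def)
  \<comment> \<open>The K-factor of this decomposition; its entry \<open>inverse y\<close> is
    integral because \<open>y\<close> has a pole.\<close>
  define k1 :: "'a mat2" where "k1 = mat22 (inverse y) 1 (- 1) 0"
  have k1: "k1 \<in> GL2_O"
    using y by (auto simp: k1_def GL2_O_iff gl2_int_iff det_mat22 integers_iff)
  have "H_map N_lower (torus_elt a b ** unip y ** k) =
      (\<chi> i. of_int (fls_subdegree (torus_elt (a * y) (b / y) $ i $ i)))"
  proof (rule H_map_eq)
    have "torus_elt a b ** unip y = mat22 1 0 (b / (a * y)) 1 ** torus_elt (a * y) (b / y) ** k1"
      using y ab by (simp add: torus_elt_def unip_def k1_def mat22_mult mat22_eq_iff field_simps)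
    then show "torus_elt a b ** unip y ** k =
        mat22 1 0 (b / (a * y)) 1 ** torus_elt (a * y) (b / y) ** (k1 ** k)"
      by (simp add: matrix_mul_assoc)
    show "k1 ** k \<in> GL2_O" using k1 k by (rule GL2_O_mult)
  qed (use ab y in \<open>auto simp: torus_elt_F N_lower_def\<close>)
  then show ?thesis
    using y ab by (simp add: vec_eq_iff forall_2 torus_elt_def fls_divide_subdegree)
qed

lemma n_of_eq_pole: "n_of (torus_elt a b ** unip y ** k) = int (pole y)"
  unfolding n_of_def H_map_upper H_map_lower
  by (rule the_equality) (auto simp: vec_eq_iff forall_2 coroot12_def)

end

section \<open>Integrality of the conjugates and the Springer fibre\<close>

lemma Ad_matrix_inv_mult:
  assumes "g \<in> GL2_F" "h \<in> GL2_F"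
  shows "Ad (matrix_inv (g ** h)) A = Ad (matrix_inv h) (Ad (matrix_inv g) A)"
proof -
  have "matrix_inv (matrix_inv h ** matrix_inv g) = g ** h"
    using assms by (simp add: matrix_inv_matrix_inv GL2_F_mult flip: matrix_inv_mult)
  then show ?thesis
    using assms by (simp add: Ad_def matrix_inv_mult matrix_inv_matrix_inv matrix_mul_assoc)
qed

lemma Ad_matrix_inv_GL2_O_iff:
  assumes "k \<in> GL2_O"
  shows "Ad (matrix_inv k) A \<in> gl2_int \<longleftrightarrow> A \<in> gl2_int"
proof -
  have imp: "Ad l B \<in> gl2_int" if "l \<in> GL2_O" "B \<in> gl2_int" for l B :: "'a mat2"
    using that GL2_O_matrix_inv[OF that(1)] by (auto simp: Ad_def GL2_O_iff gl2_int_mult)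
  have "Ad k (Ad (matrix_inv k) A) = (k ** matrix_inv k) ** A ** (k ** matrix_inv k)"
    using assms by (simp add: Ad_def matrix_mul_assoc matrix_inv_matrix_inv GL2_O_imp_GL2_F)
  also have "\<dots> = A" using assms by (simp add: matrix_inv_GL2 GL2_O_imp_GL2_F)
  finally show ?thesis using imp assms GL2_O_matrix_inv by metis
qed

text \<open>The torus part commutes with \<gamma>, and K preserves integrality. Conjugation by the
  unipotent only adds the entry \<open>alpha12 \<gamma> * y\<close>, whose valuation is
  \<open>n\<close> plus that of \<open>y\<close> when \<open>y\<close> is nonzero.\<close>

lemma Ad_gl2_int_iff:
  assumes \<gamma>: "\<gamma> \<in> torus_lie_O" "regular_element \<gamma>" "fls_subdegree (alpha12 \<gamma>) = int n"
    and ab: "a \<noteq> 0" "b \<noteq> 0" and k: "k \<in> GL2_O"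
  shows "Ad (matrix_inv (torus_elt a b ** unip y ** k)) \<gamma> \<in> gl2_int \<longleftrightarrow> pole y \<le> n"
proof -
  have g: "\<gamma> = torus_elt (\<gamma> $ 1 $ 1) (\<gamma> $ 2 $ 2)"
    using \<gamma>(1) by (simp add: torus_lie_O_def torus_elt_def mat22_eq_iff)
  have "Ad (matrix_inv (torus_elt a b)) \<gamma> = \<gamma>"
    using ab by (subst (1 2) g)
      (simp add: Ad_def matrix_inv_matrix_inv matrix_inv_torus_elt torus_elt_mult field_simps)
  moreover have "Ad (matrix_inv (unip y)) \<gamma> = mat22 (\<gamma> $ 1 $ 1) (alpha12 \<gamma> * y) 0 (\<gamma> $ 2 $ 2)"
    by (subst g) (simp add: Ad_def matrix_inv_unip,
      simp add: unip_def torus_elt_def mat22_mult mat22_eq_iff alpha12_def algebra_simps)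
  ultimately have "Ad (matrix_inv (torus_elt a b ** unip y ** k)) \<gamma> \<in> gl2_int
      \<longleftrightarrow> mat22 (\<gamma> $ 1 $ 1) (alpha12 \<gamma> * y) 0 (\<gamma> $ 2 $ 2) \<in> gl2_int"
    using ab k by (simp add: Ad_matrix_inv_mult GL2_F_mult GL2_O_imp_GL2_F Ad_matrix_inv_GL2_O_iff)
  also have "\<dots> \<longleftrightarrow> alpha12 \<gamma> * y \<in> integers"
    using \<gamma>(1) by (simp add: gl2_int_iff torus_lie_O_def)
  also have "\<dots> \<longleftrightarrow> pole y \<le> n"
    using \<gamma> by (cases "y = 0") (auto simp: regular_element_def integers_iff pole_def)
  finally show ?thesis .
qed

text \<open>The fibre only provides some representative of the coset; passing to another changes
  \<open>k\<close> alone, on which the criterion does not depend.\<close>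

lemma coset_K_springer_fibre_iff:
  assumes \<gamma>: "\<gamma> \<in> torus_lie_O" "regular_element \<gamma>" "fls_subdegree (alpha12 \<gamma>) = int n"
    and ab: "a \<noteq> 0" "b \<noteq> 0" and k: "k \<in> GL2_O"
  shows "coset_K (torus_elt a b ** unip y ** k) \<in> springer_fibre \<gamma> \<longleftrightarrow> pole y \<le> n"
proof
  let ?g = "torus_elt a b ** unip y ** k"
  have g: "?g \<in> GL2_F" using ab k by (simp add: GL2_F_mult GL2_O_imp_GL2_F)
  show "coset_K ?g \<in> springer_fibre \<gamma>" if "pole y \<le> n"
    using that g Ad_gl2_int_iff[OF assms] by (auto simp: springer_fibre_def)
  assume "coset_K ?g \<in> springer_fibre \<gamma>"
  then obtain h where h: "coset_K ?g = coset_K h" "Ad (matrix_inv h) \<gamma> \<in> gl2_int"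
    by (auto simp: springer_fibre_def)
  then obtain l where l: "l \<in> GL2_O" "h = torus_elt a b ** unip y ** (k ** l)"
    using coset_K_eq_iff[OF g] by (auto simp: matrix_mul_assoc)
  then show "pole y \<le> n"
    using h(2) Ad_gl2_int_iff[OF \<gamma> ab GL2_O_mult[OF k l(1)]] by simp
qed

lemma coset_K_springer_fibre0_iff:
  assumes \<gamma>: "\<gamma> \<in> torus_lie_O" "regular_element \<gamma>" "fls_subdegree (alpha12 \<gamma>) = int n"
    and ab: "a \<noteq> 0" "b \<noteq> 0" and k: "k \<in> GL2_O"
  shows "coset_K (torus_elt a b ** unip y ** k) \<in> springer_fibre0 \<gamma> \<longleftrightarrow>
    pole y \<le> n \<and> fls_subdegree a + fls_subdegree b = 0"
proof -
  let ?g = "torus_elt a b ** unip y ** k"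
  have g: "?g \<in> GL2_F" using ab k by (simp add: GL2_F_mult GL2_O_imp_GL2_F)
  have d: "fls_subdegree (det (?g ** l)) = fls_subdegree a + fls_subdegree b" if "l \<in> GL2_O" for l
    using that ab k by (simp add: det_mul det_torus_elt det_unip GL2_O_iff)
  have "fls_subdegree (det ?g) = fls_subdegree a + fls_subdegree b"
    using d[of "mat 1"] by simp
  moreover have "coset_K ?g \<in> springer_fibre0 \<gamma> \<longleftrightarrow>
      coset_K ?g \<in> springer_fibre \<gamma> \<and> fls_subdegree a + fls_subdegree b = 0"
  proof
    assume "coset_K ?g \<in> springer_fibre0 \<gamma>"
    then obtain h where h: "coset_K ?g = coset_K h" "coset_K h \<in> springer_fibre \<gamma>"
      "fls_subdegree (det h) = 0"
      by (auto simp: springer_fibre0_def)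
    then obtain l where "l \<in> GL2_O" "h = ?g ** l" using coset_K_eq_iff[OF g] by blast
    with h d[of l] show "coset_K ?g \<in> springer_fibre \<gamma> \<and> fls_subdegree a + fls_subdegree b = 0"
      by simp
  qed (use g calculation in \<open>auto simp: springer_fibre0_def\<close>)
  ultimately show ?thesis using coset_K_springer_fibre_iff[OF assms] by simp
qed

section \<open>Cosets and principal parts\<close>

text \<open>Canonical representatives of the series of pole order at most \<open>m\<close> modulo
  the integers.\<close>

definition principal_parts :: "nat \<Rightarrow> 'a::{field,finite} fls set" where
  "principal_parts m = {y. pole y \<le> m \<and> (\<forall>i\<ge>0. fls_nth y i = 0)}"

text \<open>Index \<open>i\<close> stands for the exponent \<open>- i - 1\<close>, so that
  \<open>i < m\<close> covers the exponents from -1 down to \<open>- m\<close>.\<close>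

lemma bij_betw_principal_parts:
  "bij_betw (\<lambda>y :: 'a::{field,finite} fls. \<lambda>i\<in>{..<m}. fls_nth y (- int i - 1))
    (principal_parts m) (PiE {..<m} (\<lambda>_. UNIV))"
proof (rule bij_betw_byWitness)
  let ?f = "\<lambda>c :: nat \<Rightarrow> 'a. Abs_fls (\<lambda>j. if - int m \<le> j \<and> j < 0 then c (nat (- j - 1)) else 0)"
  have nth: "fls_nth (?f c) j = (if - int m \<le> j \<and> j < 0 then c (nat (- j - 1)) else 0)" for c j
    by (rule nth_Abs_fls_lower_bound[of "- int m"]) auto
  have low: "fls_nth y j = 0" if "y \<in> principal_parts m" "j < - int m" for j and y :: "'a fls"
    using that by (auto simp: principal_parts_def pole_le_iff)
  show "\<forall>y\<in>principal_parts m. ?f (\<lambda>i\<in>{..<m}. fls_nth y (- int i - 1)) = y"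
    by (auto simp: fls_eq_iff nth low not_le) (auto simp: principal_parts_def)
  show "\<forall>c\<in>PiE {..<m} (\<lambda>_. UNIV). (\<lambda>i\<in>{..<m}. fls_nth (?f c) (- int i - 1)) = c"
    by (auto simp: nth fun_eq_iff PiE_def extensional_def)
  have "pole (?f c) \<le> m" for c
  proof (cases "?f c = 0")
    case True
    then show ?thesis by (simp only: pole_def fls_zero_subdegree)
  next
    case False
    then show ?thesis
      unfolding pole_le_iff by (rule fls_subdegree_geI) (simp add: nth)
  qed
  then show "?f ` PiE {..<m} (\<lambda>_. UNIV) \<subseteq> principal_parts m"
    by (auto simp: principal_parts_def nth)
qed (auto split: if_splits)

lemma finite_principal_parts [simp]: "finite (principal_parts m)"
  using bij_betw_finite[OF bij_betw_principal_parts] by (simp add: finite_PiE)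

lemma card_principal_parts:
  "card (principal_parts m :: 'a::{field,finite} fls set) = CARD('a) ^ m"
  using bij_betw_same_card[OF bij_betw_principal_parts] by (simp add: card_PiE)

lemma principal_part_exists:
  fixes y :: "'a::{field,finite} fls"
  obtains r x where "r \<in> principal_parts (pole y)" "x \<in> integers" "y = r + x"
proof -
  define x where "x = fps_to_fls (fls_regpart y)"
  have x: "x \<in> integers" by (simp add: x_def integers_def)
  have "pole (y - x) = pole y"
    using pole_add_integer[of "- x" y] x by simp
  then have "y - x \<in> principal_parts (pole y)" by (simp add: principal_parts_def x_def)
  with x that[of "y - x" x] show thesis by simp
qed

text \<open>The difference has no coefficient in negative degree, and the two series have none in
  degree 0 or above. This later separates the classes being counted.\<close>

lemma principal_parts_eqI:
  assumes "r \<in> principal_parts m" "s \<in> principal_parts n" "r - s \<in> integers"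
  shows "r = s"
proof (rule fls_eqI)
  fix j show "fls_nth r j = fls_nth s j"
  proof (cases "j < 0")
    case True
    then have "fls_nth (r - s) j = 0"
      using assms(3) by (intro fls_eq0_below_subdegree) (auto simp: integers_iff)
    then show ?thesis by simp
  qed (use assms in \<open>simp add: principal_parts_def\<close>)
qed

text \<open>\<open>l\<close> is the only solution of \<open>?g ** l = ?h\<close>, so the cosets
  agree exactly when \<open>l\<close> lies in K. Its diagonal yields the two equalities of
  valuations; granted these, \<open>c / a\<close> is a unit and the off-diagonal entry is a unit
  multiple of the third expression.\<close>

lemma coset_K_torus_unip_eq_iff:
  assumes "a \<noteq> 0" "b \<noteq> 0" "c \<noteq> 0" "d \<noteq> 0"
  shows "coset_K (torus_elt a b ** unip y) = coset_K (torus_elt c d ** unip z) \<longleftrightarrow>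
    fls_subdegree a = fls_subdegree c \<and> fls_subdegree b = fls_subdegree d \<and>
    (a * d / (b * c)) * y - z \<in> integers"
proof -
  let ?g = "torus_elt a b ** unip y" and ?h = "torus_elt c d ** unip z"
  define l where "l = mat22 (c / a) (c * z / a - d * y / b) 0 (d / b)"
  have gl: "?g ** l = ?h"
    using assms by (simp add: l_def torus_elt_def unip_def mat22_mult mat22_eq_iff field_simps)
  have g: "?g \<in> GL2_F" using assms by (simp add: GL2_F_mult)
  have "k = l" if "?h = ?g ** k" for k
  proof -
    have "matrix_inv ?g ** (?g ** k) = matrix_inv ?g ** (?g ** l)" using gl that by simp
    then have "(matrix_inv ?g ** ?g) ** k = (matrix_inv ?g ** ?g) ** l"
      by (simp only: matrix_mul_assoc)
    then show ?thesis using g by (simp add: matrix_inv_GL2)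
  qed
  then have "coset_K ?g = coset_K ?h \<longleftrightarrow> l \<in> GL2_O"
    using coset_K_eq_iff[OF g, of ?h] gl by metis
  also have "\<dots> \<longleftrightarrow> fls_subdegree a = fls_subdegree c \<and> fls_subdegree b = fls_subdegree d \<and>
    (a * d / (b * c)) * y - z \<in> integers"
  proof -
    have dg: "c / a \<in> integers \<and> d / b \<in> integers \<and> fls_subdegree (c / a * (d / b)) = 0 \<longleftrightarrow>
        fls_subdegree a = fls_subdegree c \<and> fls_subdegree b = fls_subdegree d"
      using assms by (auto simp: integers_iff fls_divide_subdegree)
    have e: "c * z / a - d * y / b = - (c / a) * ((a * d / (b * c)) * y - z)"
      using assms by (simp add: field_simps)
    have "c * z / a - d * y / b \<in> integers \<longleftrightarrow> (a * d / (b * c)) * y - z \<in> integers"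
      if "fls_subdegree a = fls_subdegree c"
      unfolding e using assms that
      by (cases "(a * d / (b * c)) * y - z = 0") (auto simp: integers_iff fls_divide_subdegree)
    with dg show ?thesis
      using assms by (auto simp: l_def GL2_O_iff gl2_int_iff det_mat22)
  qed
  finally show ?thesis .
qed

lemma coset_K_mult_GL2_O: "g \<in> GL2_F \<Longrightarrow> k \<in> GL2_O \<Longrightarrow> coset_K (g ** k) = coset_K g"
  by (metis coset_K_eq_iff)

lemma coset_K_torus_normal_form:
  fixes y :: "'a::{field,finite} fls"
  assumes "a \<noteq> 0" "b \<noteq> 0" "k \<in> GL2_O"
  obtains r where "r \<in> principal_parts (pole y)" "pole r = pole y"
    "coset_K (torus_elt a b ** unip y ** k) =
      coset_K (torus_elt (fls_X_intpow (fls_subdegree a)) (fls_X_intpow (fls_subdegree b)) ** unip r)"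
proof -
  define i j where "i = fls_subdegree a" and "j = fls_subdegree b"
  \<comment> \<open>The factor \<open>a * d / (b * c)\<close> of the coset criterion, with powers of
    the uniformizer for \<open>c\<close> and \<open>d\<close>: it carries the unit parts of
    \<open>a\<close> and \<open>b\<close> over to \<open>y\<close>.\<close>
  define w :: "'a fls" where "w = a * fls_X_intpow j / (b * fls_X_intpow i)"
  have w: "w \<noteq> 0" "fls_subdegree w = 0"
    using assms by (simp_all add: w_def i_def j_def fls_divide_subdegree del: fls_shift_eq0_iff)
  obtain r x where r: "r \<in> principal_parts (pole (w * y))" "x \<in> integers" "w * y = r + x"
    by (rule principal_part_exists)
  have p: "pole (w * y) = pole y" using w by (rule pole_unit_mult)
  have "pole r = pole (w * y)" using r pole_add_integer[of x r] by simp
  moreover have "coset_K (torus_elt a b ** unip y) =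
      coset_K (torus_elt (fls_X_intpow i) (fls_X_intpow j) ** unip r)"
  proof (subst coset_K_torus_unip_eq_iff, goal_cases)
    case 5
    have "w * y - r \<in> integers" using r by simp
    then show ?case by (simp add: i_def j_def w_def)
  qed (use assms in auto)
  ultimately show thesis
    using r p assms that[of r] by (simp add: coset_K_mult_GL2_O GL2_F_mult i_def j_def)
qed

section \<open>Points of the truncated fibre\<close>

lemma coroot12_nth [simp]: "coroot12 $ 1 = 1" "coroot12 $ 2 = - 1"
  by (simp_all add: coroot12_def)

lemma vector_eq_scaleR_coroot12: "vector [r, - r] = r *\<^sub>R coroot12"
  by (simp add: vec_eq_iff forall_2)

lemma closed_segment_coroot12:
  "closed_segment (p *\<^sub>R coroot12) (q *\<^sub>R coroot12) = (\<lambda>r. r *\<^sub>R coroot12) ` closed_segment p q"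
  by (rule closed_segment_linear_image) (simp add: linear_iff scaleR_left_distrib)

lemma coroot12_segment_subset_iff:
  assumes "q \<le> p" "q' \<le> p'"
  shows "closed_segment (p *\<^sub>R coroot12) (q *\<^sub>R coroot12) \<subseteq>
      closed_segment (p' *\<^sub>R coroot12) (q' *\<^sub>R coroot12) \<longleftrightarrow> q' \<le> q \<and> p \<le> p'"
proof -
  have "inj (\<lambda>r. r *\<^sub>R coroot12)" by (rule injI) (simp add: vec_eq_iff forall_2)
  moreover have "closed_segment p q = {q..p}" "closed_segment p' q' = {q'..p'}"
    using assms by (auto simp: closed_segment_eq_real_ivl)
  ultimately have "closed_segment (p *\<^sub>R coroot12) (q *\<^sub>R coroot12) \<subseteq>
      closed_segment (p' *\<^sub>R coroot12) (q' *\<^sub>R coroot12) \<longleftrightarrow> {q..p} \<subseteq> {q'..p'}"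
    by (simp only: closed_segment_coroot12 inj_image_subset_iff)
  with assms show ?thesis by auto
qed

lemma weyl_act_weyl_s: "weyl_act weyl_s v = vector [v $ 2, v $ 1]"
proof -
  have "inv weyl_s = weyl_s"
    unfolding weyl_s_def by (rule inv_unique_comp) auto
  then show ?thesis by (simp add: weyl_act_def weyl_s_def vec_eq_iff forall_2)
qed

lemma weyl_s_neq_id [simp]: "weyl_s \<noteq> id"
proof
  assume "weyl_s = id"
  then have "weyl_s 1 = id 1" by simp
  then show False by (simp add: weyl_s_def)
qed


text \<open>\<open>n + 1 - pole r\<close> counts the \<open>j\<close> from \<open>pole r\<close> to
  \<open>n\<close>. After exchanging the sums, each \<open>j\<close> contributes the number of
  principal parts of pole order at most \<open>j\<close>.\<close>

lemma sum_principal_parts_pole: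
  "(\<Sum>r\<in>(principal_parts n :: 'a::{field,finite} fls set). n + 1 - pole r) = (\<Sum>j=0..n. CARD('a) ^ j)"
proof -
  have "(\<Sum>r\<in>(principal_parts n :: 'a fls set). n + 1 - pole r) =
      (\<Sum>r\<in>principal_parts n. \<Sum>j=0..n. of_bool (pole (r :: 'a fls) \<le> j))"
  proof (rule sum.cong)
    fix r :: "'a fls"
    have "{0..n} \<inter> {j. pole r \<le> j} = {pole r..n}" by auto
    then show "n + 1 - pole r = (\<Sum>j=0..n. of_bool (pole r \<le> j))"
      by (simp add: of_bool_def sum.If_cases)
  qed simp
  also have "\<dots> = (\<Sum>j=0..n. \<Sum>r\<in>principal_parts n. of_bool (pole (r :: 'a fls) \<le> j))"
    by (rule sum.swap)
  also have "\<dots> = (\<Sum>j=0..n. CARD('a) ^ j)"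
  proof (rule sum.cong)
    fix j assume "j \<in> {0..n}"
    then have "principal_parts n \<inter> {r. pole r \<le> j} = (principal_parts j :: 'a fls set)"
      by (auto simp: principal_parts_def)
    then show "(\<Sum>r\<in>principal_parts n. of_bool (pole (r :: 'a fls) \<le> j)) = CARD('a) ^ j"
      by (simp add: of_bool_def sum.If_cases card_principal_parts)
  qed simp
  finally show ?thesis .
qed

text \<open>Regularity is only maximality, so the maximum must be shown to be \<open>n\<close>: the
  point with unipotent entry of valuation \<open>- n\<close> lies in the fibre and attains the
  bound. Determinant valuation 0 puts both vertices on the coroot line.\<close>

lemma regular_point_normal_form:
  fixes \<gamma> x0 :: "'a::{field,finite} mat2"
  assumes \<gamma>: "\<gamma> \<in> torus_lie_O" "regular_element \<gamma>" "fls_subdegree (alpha12 \<gamma>) = int n"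
    and x0: "coset_K x0 \<in> springer_fibre0 \<gamma>" "regular_point \<gamma> x0"
  obtains k0 :: int where "H_map N_upper x0 = real_of_int k0 *\<^sub>R coroot12"
    "H_map N_lower x0 = (real_of_int k0 - real n) *\<^sub>R coroot12"
proof -
  have "x0 \<in> GL2_F" using x0 by (simp add: regular_point_def)
  then obtain c d y k where ck: "c \<noteq> 0" "d \<noteq> 0" "k \<in> GL2_O"
    and x0_eq: "x0 = torus_elt c d ** unip y ** k" by (rule iwasawa)
  have y: "pole y \<le> n" and cd: "fls_subdegree d = - fls_subdegree c"
    using x0(1) coset_K_springer_fibre0_iff[OF \<gamma> ck] by (auto simp: x0_eq)
  let ?z = "fls_X_intpow (- int n) :: 'a fls"
  let ?h = "torus_elt 1 1 ** unip ?z ** mat 1"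
  have pz: "pole ?z = n"
    unfolding pole_def by (subst fls_subdegree_fls_X_intpow) simp
  have h: "?h \<in> GL2_F" by (simp add: GL2_F_mult)
  have "coset_K ?h \<in> springer_fibre \<gamma>"
    using coset_K_springer_fibre_iff[OF \<gamma>, of 1 1 "mat 1" ?z] pz by simp
  then have "n_of ?h \<le> n_of x0" using x0(2) h by (auto simp only: regular_point_def)
  moreover have "n_of ?h = int n"
    using n_of_eq_pole[of 1 1 "mat 1" ?z] pz by simp
  moreover have "n_of x0 = int (pole y)" using n_of_eq_pole[OF ck] by (simp add: x0_eq)
  ultimately have "pole y = n" using y by simp
  then show thesis
    using that[of "fls_subdegree c"] H_map_upper[OF ck, of y] H_map_lower[OF ck, of y]
    by (simp add: x0_eq cd flip: vector_eq_scaleR_coroot12)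
qed

lemma card_springer_fibre0_trunc:
  fixes \<gamma> x0 :: "'a::{field,finite} mat2"
  assumes \<gamma>: "\<gamma> \<in> torus_lie_O" "regular_element \<gamma>" "fls_subdegree (alpha12 \<gamma>) = int n"
    and x0: "coset_K x0 \<in> springer_fibre0 \<gamma>" "regular_point \<gamma> x0"
  shows "card (springer_fibre0_trunc \<gamma> (family_segment (Pi_vertex x0 a))) =
    (\<Sum>i=0..n. CARD('a) ^ i) + 2 * a * CARD('a) ^ n"
proof -
  obtain k0 where k0: "H_map N_upper x0 = real_of_int k0 *\<^sub>R coroot12"
    "H_map N_lower x0 = (real_of_int k0 - real n) *\<^sub>R coroot12"
    using regular_point_normal_form[OF assms] by blast
  let ?S = "family_segment (Pi_vertex x0 a)"
  have "weyl_act id v = v" for v by (simp add: weyl_act_def vec_eq_iff)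
  \<comment> \<open>The reflection negates the coroot, so the lower vertex moves down by
    \<open>a\<close> while the upper one moves up by \<open>a\<close>.\<close>
  moreover have "weyl_act weyl_s (real a *\<^sub>R coroot12) = (- real a) *\<^sub>R coroot12"
    by (simp add: weyl_act_weyl_s vec_eq_iff forall_2)
  ultimately have S: "?S = closed_segment ((real_of_int k0 + real a) *\<^sub>R coroot12)
      ((real_of_int k0 - real n - real a) *\<^sub>R coroot12)"
    by (simp add: family_segment_def Pi_vertex_def Sigma_vertex_def k0
        scaleR_left_distrib scaleR_left_diff_distrib)
  \<comment> \<open>In coroot coordinates the segment runs from the valuation of \<open>c\<close>
    down by \<open>pole y\<close>; each end yields one inequality.\<close>
  have Ec: "Ec (torus_elt c d ** unip y ** k) \<subseteq> ?S \<longleftrightarrow>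
      k0 - int n - int a + int (pole y) \<le> fls_subdegree c \<and> fls_subdegree c \<le> k0 + int a"
    if "c \<noteq> 0" "d \<noteq> 0" "k \<in> GL2_O" "fls_subdegree c + fls_subdegree d = 0" for c d y k
  proof -
    have d: "fls_subdegree d = - fls_subdegree c" using that by simp
    have "Ec (torus_elt c d ** unip y ** k) =
        closed_segment (real_of_int (fls_subdegree c) *\<^sub>R coroot12)
          ((real_of_int (fls_subdegree c) - real (pole y)) *\<^sub>R coroot12)"
      using that by (simp add: Ec_def H_map_upper H_map_lower d flip: vector_eq_scaleR_coroot12)
    then show ?thesis unfolding S by (simp add: coroot12_segment_subset_iff) linarith
  qed
  let ?f = "\<lambda>(r, k). coset_K (torus_elt (fls_X_intpow k) (fls_X_intpow (- k)) ** unip r) :: 'a mat2 set"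
  let ?I = "SIGMA r:(principal_parts n :: 'a fls set). {k0 - int n - int a + int (pole r)..k0 + int a}"
  have "springer_fibre0_trunc \<gamma> ?S = ?f ` ?I"
  proof (intro equalityI subsetI)
    fix C assume "C \<in> springer_fibre0_trunc \<gamma> ?S"
    then obtain g where g: "C = coset_K g" "g \<in> GL2_F" "coset_K g \<in> springer_fibre0 \<gamma>" "Ec g \<subseteq> ?S"
      by (auto simp: springer_fibre0_trunc_def)
    obtain c d y k where ck: "c \<noteq> 0" "d \<noteq> 0" "k \<in> GL2_O" and g_eq: "g = torus_elt c d ** unip y ** k"
      using iwasawa[OF g(2)] .
    obtain r where r: "r \<in> principal_parts (pole y)" "pole r = pole y"
      "C = coset_K (torus_elt (fls_X_intpow (fls_subdegree c)) (fls_X_intpow (fls_subdegree d)) ** unip r)"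
      using coset_K_torus_normal_form[OF ck, of y] by (auto simp: g g_eq)
    have "pole y \<le> n" and cd: "fls_subdegree d = - fls_subdegree c"
      using g coset_K_springer_fibre0_iff[OF \<gamma> ck] by (auto simp: g_eq)
    then have "(r, fls_subdegree c) \<in> ?I"
      using Ec[OF ck, of y] g r by (auto simp: g_eq principal_parts_def)
    moreover have "C = ?f (r, fls_subdegree c)" using r cd by simp
    ultimately show "C \<in> ?f ` ?I" by blast
  next
    fix C assume "C \<in> ?f ` ?I"
    then obtain r k where rk: "r \<in> principal_parts n" "k \<in> {k0 - int n - int a + int (pole r)..k0 + int a}"
      and C: "C = coset_K (torus_elt (fls_X_intpow k) (fls_X_intpow (- k)) ** unip r ** mat 1)" by auto
    let ?c = "fls_X_intpow k :: 'a fls" and ?d = "fls_X_intpow (- k) :: 'a fls"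
    let ?g = "torus_elt ?c ?d ** unip r ** mat 1"
    have val: "fls_subdegree ?c = k" "fls_subdegree ?d = - k" and nz: "?c \<noteq> 0" "?d \<noteq> 0"
      by (rule fls_subdegree_fls_X_intpow fls_X_intpow_nonzero)+
    have "?g \<in> GL2_F" using nz by (simp add: GL2_F_mult)
    moreover have "coset_K ?g \<in> springer_fibre0 \<gamma>"
      using coset_K_springer_fibre0_iff[OF \<gamma> nz mat_1_GL2_O, of r] rk val
      by (simp only: principal_parts_def) simp
    moreover have "Ec ?g \<subseteq> ?S"
      using Ec[OF nz mat_1_GL2_O, of r] rk val by (simp only:) simp
    ultimately show "C \<in> springer_fibre0_trunc \<gamma> ?S"
      unfolding springer_fibre0_trunc_def C by blast
  qed
  moreover have "inj_on ?f ?I"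
  proof (rule inj_onI, clarify)
    fix r s :: "'a fls" and k l :: int
    assume rs: "r \<in> principal_parts n" "s \<in> principal_parts n"
      and eq: "coset_K (torus_elt (fls_X_intpow k) (fls_X_intpow (- k)) ** unip r) =
        coset_K (torus_elt (fls_X_intpow l) (fls_X_intpow (- l)) ** unip s)"
    have *: "fls_subdegree (fls_X_intpow k :: 'a fls) = fls_subdegree (fls_X_intpow l :: 'a fls)"
      "fls_X_intpow k * fls_X_intpow (- l) / (fls_X_intpow (- k) * fls_X_intpow l) * r - s \<in> integers"
      using eq unfolding coset_K_torus_unip_eq_iff[OF fls_X_intpow_nonzero fls_X_intpow_nonzero
        fls_X_intpow_nonzero fls_X_intpow_nonzero] by blast+
    then have "k = l" unfolding fls_subdegree_fls_X_intpow by blast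
    \<comment> \<open>With equal exponents the scaling factor is 1, so that \<open>r - s\<close>
      itself is integral.\<close>
    moreover have "fls_X_intpow l * fls_X_intpow (- l) / (fls_X_intpow (- l) * fls_X_intpow l) = (1 :: 'a fls)"
      by (metis divide_self fls_X_intpow_nonzero mult.commute mult_eq_0_iff)
    ultimately show "r = s \<and> k = l" using *(2) principal_parts_eqI[OF rs] by (simp only: mult_1_left)
  qed
  ultimately have "card (springer_fibre0_trunc \<gamma> ?S) = card ?I"
    by (simp add: card_image)
  also have "\<dots> = (\<Sum>r\<in>(principal_parts n :: 'a fls set). 2 * a + (n + 1 - pole r))"
  proof -
    \<comment> \<open>Isolating \<open>2 * a\<close> leaves the summand of
      \<open>sum_principal_parts_pole\<close>; the natural subtraction is exact because
      \<open>pole r \<le> n\<close>.\<close>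
    have "nat (2 * int a + (int n - int (pole r)) + 1) = 2 * a + (Suc n - pole r)"
      if "r \<in> principal_parts n" for r :: "'a fls"
      using that by (auto simp: principal_parts_def)
    then show ?thesis by (subst card_SigmaI) (auto intro!: sum.cong)
  qed
  also have "\<dots> = (\<Sum>i=0..n. CARD('a) ^ i) + 2 * a * CARD('a) ^ n"
    by (subst sum.distrib, subst sum_principal_parts_pole) (simp add: card_principal_parts)
  finally show ?thesis .
qed

section \<open>Topology of \<open>GL\<^sub>2(F)\<close>\<close>

text \<open>The distance is 2 to minus the valuation of the difference, defined in two branches with
  natural exponents. A negative valuation would give distance at least 1.\<close>

lemma dist_fls_lessD:
  fixes x y :: "'a::{field,finite} fls"
  assumes "dist x y < inverse (2 ^ N)"
  obtains z where "z \<in> integers" "x - y = fls_X ^ N * z"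
proof (cases "x = y")
  case True
  then show thesis using that[of 0] by simp
next
  case False
  have "int N \<le> fls_subdegree (x - y)"
  proof (cases "0 \<le> fls_subdegree (x - y)")
    case True
    then have "inverse (2 ^ nat (fls_subdegree (x - y))) < inverse (2 ^ N :: real)"
      using assms False by (simp add: dist_fls_def)
    then have "(2 :: real) ^ N < 2 ^ nat (fls_subdegree (x - y))" by simp
    then show ?thesis using True by simp
  next
    case neg: False
    then have "2 ^ nat (- fls_subdegree (x - y)) < inverse (2 ^ N :: real)"
      using assms False by (simp add: dist_fls_def)
    also have "\<dots> \<le> 1" by (simp add: inverse_le_1_iff)
    finally show ?thesis by (metis one_le_numeral one_le_power not_less)
  qed
  then have N: "int N \<le> fls_subdegree (x - y)" "x - y \<noteq> 0" using False by simp_all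
  have *: "fls_shift (int N) d \<in> integers" "d = fls_X ^ N * fls_shift (int N) d"
    if "int N \<le> fls_subdegree d" "d \<noteq> 0" for d :: "'a fls"
    using that by (simp_all add: integers_iff fls_X_power_times_conv_shift)
  show thesis by (rule that[OF *(1)[OF N] *(2)[OF N]])
qed

lemma one_plus_fls_X_mult_unit:
  assumes "w \<in> integers"
  shows "1 + fls_X * w \<noteq> 0" "fls_subdegree (1 + fls_X * w) = 0"
proof -
  have "fls_nth (fls_X * w) j = 0" if "j \<le> 0" for j
    using that assms by (simp add: fls_X_times_conv_shift integers_iff)
  then have "fls_nth (1 + fls_X * w) 0 = 1" "\<And>j. j < 0 \<Longrightarrow> fls_nth (1 + fls_X * w) j = 0" by simp_all
  then show "1 + fls_X * w \<noteq> 0" "fls_subdegree (1 + fls_X * w) = 0"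
    using fls_subdegree_eqI[of "1 + fls_X * w" 0] by force+
qed

lemma fls_X_integers [simp]: "fls_X \<in> integers"
  by (simp add: integers_iff)

text \<open>The determinant is 1 modulo the uniformizer, hence a unit: the first congruence subgroup
  lies in K.\<close>

lemma one_plus_fls_X_gl2_int_GL2_O:
  assumes "Z \<in> gl2_int"
  shows "(\<chi> i j. mat 1 $ i $ j + fls_X * Z $ i $ j) \<in> GL2_O" (is "?k \<in> _")
proof -
  have Z: "Z $ i $ j \<in> integers" for i j using assms by (simp add: gl2_int_def)
  have "det ?k = 1 + fls_X * (Z $ 1 $ 1 + Z $ 2 $ 2 +
      fls_X * (Z $ 1 $ 1 * Z $ 2 $ 2 - Z $ 1 $ 2 * Z $ 2 $ 1))"
    by (simp add: det_2 mat_def algebra_simps)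
  moreover have "Z $ 1 $ 1 + Z $ 2 $ 2 + fls_X * (Z $ 1 $ 1 * Z $ 2 $ 2 - Z $ 1 $ 2 * Z $ 2 $ 1) \<in> integers"
    using Z by (intro integers_add integers_diff integers_mult) auto
  moreover have "?k \<in> gl2_int"
    using Z by (auto simp: gl2_int_def mat_def intro!: integers_add integers_mult)
  ultimately show ?thesis by (simp add: GL2_O_iff one_plus_fls_X_mult_unit)
qed

text \<open>If \<open>h\<close> is close enough to \<open>g\<close>, then \<open>G ** h\<close>,
  with \<open>G\<close> the inverse of \<open>g\<close>, lies in the first congruence subgroup, so
  \<open>h\<close> lies in the coset of \<open>g\<close>.\<close>

lemma open_right_GL2_O_invariant:
  fixes S :: "'a::{field,finite} mat2 set"
  assumes "S \<subseteq> GL2_F" and inv: "\<And>g k. g \<in> S \<Longrightarrow> k \<in> GL2_O \<Longrightarrow> g ** k \<in> S"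
  shows "open S"
  unfolding open_dist
proof
  fix g assume g: "g \<in> S"
  then have gF: "g \<in> GL2_F" using assms(1) by auto
  define G where "G = matrix_inv g"
  \<comment> \<open>\<open>M\<close> powers of the uniformizer clear the poles of \<open>G\<close>;
    the radius uses \<open>Suc M\<close> so that one more power is left for the congruence
    condition.\<close>
  define M where "M = pole (G $ 1 $ 1) + pole (G $ 1 $ 2) + pole (G $ 2 $ 1) + pole (G $ 2 $ 2)"
  have GM: "fls_X ^ M * G $ i $ j \<in> integers" for i j
  proof -
    have "pole (G $ i $ j) \<le> M" using exhaust_2[of i] exhaust_2[of j] by (auto simp: M_def)
    then show ?thesis by (cases "G $ i $ j = 0") (auto simp: integers_iff pole_le_iff)
  qed
  have "h \<in> S" if d: "dist h g < inverse (2 ^ Suc M)" for h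
  proof -
    have "\<exists>z. z \<in> integers \<and> h $ i $ j - g $ i $ j = fls_X ^ Suc M * z" for i j
    proof -
      have "dist (h $ i $ j) (g $ i $ j) < inverse (2 ^ Suc M)"
        using d dist_vec_nth_le[of h i g] dist_vec_nth_le[of "h $ i" j "g $ i"] by linarith
      then show ?thesis by (rule dist_fls_lessD) blast
    qed
    then obtain Z where Z: "\<And>i j. Z i j \<in> integers \<and> h $ i $ j - g $ i $ j = fls_X ^ Suc M * Z i j"
      by metis
    then have Z: "Z i j \<in> integers" "h $ i $ j - g $ i $ j = fls_X ^ Suc M * Z i j" for i j
      by blast+
    define Y where "Y = (\<chi> i j. fls_X ^ M * G $ i $ 1 * Z 1 j + fls_X ^ M * G $ i $ 2 * Z 2 j)"
    have "Y \<in> gl2_int"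
      by (auto simp: Y_def gl2_int_def intro!: integers_add integers_mult[OF GM Z(1)])
    then have k: "(\<chi> i j. mat 1 $ i $ j + fls_X * Y $ i $ j) \<in> GL2_O"
      by (rule one_plus_fls_X_gl2_int_GL2_O)
    have "G ** h = (\<chi> i j. mat 1 $ i $ j + fls_X * Y $ i $ j)"
    proof -
      have h: "h $ i $ j = g $ i $ j + fls_X ^ Suc M * Z i j" for i j
        using Z(2)[of i j] by (simp add: algebra_simps)
      have "(G ** h) $ i $ j = (G ** g) $ i $ j + fls_X * Y $ i $ j" for i j
        by (simp add: mult_nth_2 h Y_def algebra_simps)
      then show ?thesis using gF by (simp add: vec_eq_iff G_def matrix_inv_GL2)
    qed
    with k have "g ** (G ** h) \<in> S" using inv g by simp
    also have "g ** (G ** h) = h"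
      using gF by (simp add: G_def matrix_mul_assoc matrix_inv_GL2)
    finally show ?thesis .
  qed
  then show "\<exists>e>0. \<forall>h. dist h g < e \<longrightarrow> h \<in> S"
    by (intro exI[of _ "inverse (2 ^ Suc M)"]) auto
qed

section \<open>Unipotent balls and their intersections with torus orbits\<close>

definition unip_ball :: "nat \<Rightarrow> 'a::{field,finite} mat2 set" where
  "unip_ball m = (\<Union>r\<in>principal_parts m. coset_K (unip r))"

text \<open>The defining union is finite, with pairwise disjoint terms, which suits the computation
  of the volume; this form suits membership tests.\<close>

lemma unip_ball_eq: "unip_ball m = {unip y ** k | y k. pole y \<le> m \<and> k \<in> GL2_O}"
proof (intro equalityI subsetI)
  fix g assume "g \<in> {unip y ** k | y k. pole y \<le> m \<and> k \<in> GL2_O}"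
  then obtain y k where g: "g = unip y ** k" "pole y \<le> m" "k \<in> GL2_O" by auto
  obtain r x where r: "r \<in> principal_parts (pole y)" "x \<in> integers" "y = r + x"
    by (rule principal_part_exists)
  have "g = unip r ** (unip x ** k)" by (simp add: g r unip_mult matrix_mul_assoc)
  moreover have "unip x ** k \<in> GL2_O" using g r by (simp add: GL2_O_mult unip_GL2_O)
  moreover have "r \<in> principal_parts m" using r g by (auto simp: principal_parts_def)
  ultimately show "g \<in> unip_ball m" by (auto simp: unip_ball_def coset_K_def)
qed (auto simp: unip_ball_def coset_K_def principal_parts_def)

text \<open>Comparing \<open>H_map N_upper\<close> and \<open>n_of\<close> on two decompositions
  forces the torus entries to be units and the pole orders to agree. Conversely, an integral torus
  element moves past the unipotent into K, scaling \<open>y\<close> by a unit.\<close>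

lemma torus_unip_mem_unip_ball_iff:
  assumes ab: "a \<noteq> 0" "b \<noteq> 0" and k: "k \<in> GL2_O"
  shows "torus_elt a b ** unip y ** k \<in> unip_ball m \<longleftrightarrow> torus_elt a b \<in> GL2_O \<and> pole y \<le> m"
proof
  assume "torus_elt a b ** unip y ** k \<in> unip_ball m"
  then obtain z l where z: "pole z \<le> m" "l \<in> GL2_O" "torus_elt a b ** unip y ** k = unip z ** l"
    by (auto simp: unip_ball_eq)
  then have eq: "torus_elt a b ** unip y ** k = torus_elt 1 1 ** unip z ** l"
    by (simp add: torus_elt_def flip: mat_1_eq_mat22)
  have "fls_subdegree a = 0 \<and> fls_subdegree b = 0"
    using arg_cong[OF eq, of "H_map N_upper"]
    unfolding H_map_upper[OF ab k] H_map_upper[OF one_neq_zero one_neq_zero z(2)]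
    by (simp add: vec_eq_iff forall_2)
  moreover have "pole y = pole z"
    using arg_cong[OF eq, of n_of]
    unfolding n_of_eq_pole[OF ab k] n_of_eq_pole[OF one_neq_zero one_neq_zero z(2)] by simp
  ultimately show "torus_elt a b \<in> GL2_O \<and> pole y \<le> m"
    using ab z by (simp add: torus_elt_GL2_O)
next
  assume *: "torus_elt a b \<in> GL2_O \<and> pole y \<le> m"
  then have "pole (a / b * y) \<le> m"
    using ab by (subst pole_unit_mult) (auto simp: torus_elt_GL2_O fls_divide_subdegree)
  moreover have "torus_elt a b ** unip y ** k = unip (a / b * y) ** (torus_elt a b ** k)"
    using ab by (simp add: unip_torus_elt matrix_mul_assoc)
  ultimately show "torus_elt a b ** unip y ** k \<in> unip_ball m"
    using * k GL2_O_mult by (auto simp: unip_ball_eq)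
qed

lemma unip_ball_subset: "unip_ball m \<subseteq> GL2_F"
  by (auto simp: unip_ball_eq GL2_F_mult GL2_O_imp_GL2_F)

lemma open_unip_ball: "open (unip_ball m :: 'a::{field,finite} mat2 set)"
proof (rule open_right_GL2_O_invariant)
  fix g k :: "'a mat2" assume "g \<in> unip_ball m" "k \<in> GL2_O"
  then obtain y l where "g = unip y ** l" "pole y \<le> m" "l \<in> GL2_O" "k \<in> GL2_O"
    by (auto simp: unip_ball_eq)
  moreover from this have "g ** k = unip y ** (l ** k)" by (simp add: matrix_mul_assoc)
  ultimately show "g ** k \<in> unip_ball m" using GL2_O_mult by (auto simp: unip_ball_eq)
qed (rule unip_ball_subset)

lemma n_of_torus_left:
  assumes "t \<in> torus_F" "g \<in> GL2_F"
  shows "n_of (t ** g) = n_of g"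
proof -
  obtain c d where t: "c \<noteq> 0" "d \<noteq> 0" "t = torus_elt c d" using assms(1) by (rule torus_F_cases)
  obtain a b y k where *: "a \<noteq> 0" "b \<noteq> 0" "k \<in> GL2_O" and g: "g = torus_elt a b ** unip y ** k"
    using assms(2) by (rule iwasawa)
  have "t ** g = torus_elt (c * a) (d * b) ** unip y ** k"
    by (simp add: t g matrix_mul_assoc torus_elt_mult)
  then show ?thesis using t * by (simp add: g n_of_eq_pole)
qed

lemma n_of_GL2_O_right:
  assumes "g \<in> GL2_F" "l \<in> GL2_O"
  shows "n_of (g ** l) = n_of g"
proof -
  obtain a b y k where *: "a \<noteq> 0" "b \<noteq> 0" "k \<in> GL2_O" and g: "g = torus_elt a b ** unip y ** k"
    using assms(1) by (rule iwasawa)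
  show ?thesis
    using * assms(2) n_of_eq_pole[of a b "k ** l" y] n_of_eq_pole[of a b k y]
    by (simp add: g GL2_O_mult matrix_mul_assoc)
qed

lemma torus_F_mult: "s \<in> torus_F \<Longrightarrow> t \<in> torus_F \<Longrightarrow> s ** t \<in> torus_F"
  by (simp add: torus_F_def GL2_F_mult mult_nth_2)

lemma torus_F_matrix_inv: "t \<in> torus_F \<Longrightarrow> matrix_inv t \<in> torus_F"
  by (metis torus_F_cases matrix_inv_torus_elt torus_elt_F nonzero_imp_inverse_nonzero)

lemma torus_F_imp_GL2_F: "t \<in> torus_F \<Longrightarrow> t \<in> GL2_F"
  by (simp add: torus_F_def)

lemma mat_1_torus_F [simp]: "mat 1 \<in> torus_F"
  by (simp add: mat_1_eq_mat22 torus_F_def GL2_F_iff det_mat22)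

text \<open>Left translation by \<open>t\<close> multiplies the torus part of \<open>g\<close> by
  \<open>t\<close> and keeps \<open>y\<close>, so the product of the two torus elements must lie in
  T(O). The \<open>s\<close> obtained is thus the inverse of the torus part of
  \<open>g\<close>.\<close>

lemma torus_translate_unip_ball:
  fixes g :: "'a::{field,finite} mat2"
  assumes "g \<in> GL2_F"
  obtains s where "s \<in> torus_F"
    "{t \<in> torus_F. t ** g \<in> unip_ball m} = (if n_of g \<le> int m then (\<lambda>t. s ** t) ` torus_O else {})"
proof -
  obtain a b y k where *: "a \<noteq> 0" "b \<noteq> 0" "k \<in> GL2_O" and g: "g = torus_elt a b ** unip y ** k"
    using assms by (rule iwasawa)
  define s where "s = torus_elt a b"
  have s: "s \<in> torus_F" using * by (simp add: s_def torus_elt_F)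
  have mem: "t ** g \<in> unip_ball m \<longleftrightarrow> s ** t \<in> torus_O \<and> n_of g \<le> int m" if t_in: "t \<in> torus_F" for t
  proof -
    obtain c d where t: "c \<noteq> 0" "d \<noteq> 0" "t = torus_elt c d" using t_in by (rule torus_F_cases)
    have "t ** g = torus_elt (a * c) (b * d) ** unip y ** k"
      by (simp add: t g matrix_mul_assoc torus_elt_mult mult.commute)
    then show ?thesis
      using t * by (simp add: torus_unip_mem_unip_ball_iff n_of_eq_pole g s_def torus_elt_mult
          torus_O_def torus_elt_F)
  qed
  have inv: "matrix_inv s \<in> torus_F" "matrix_inv s ** (s ** t) = t" "s ** (matrix_inv s ** t) = t"
    for t :: "'a mat2"
    using s by (simp_all add: torus_F_matrix_inv matrix_mul_assoc matrix_inv_GL2 torus_F_imp_GL2_F)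
  have "{t \<in> torus_F. s ** t \<in> torus_O} = (\<lambda>t. matrix_inv s ** t) ` torus_O"
  proof (intro equalityI subsetI)
    fix t assume "t \<in> {t \<in> torus_F. s ** t \<in> torus_O}"
    then show "t \<in> (\<lambda>t. matrix_inv s ** t) ` torus_O" by (intro image_eqI[of _ _ "s ** t"]) (auto simp: inv)
  next
    fix t assume "t \<in> (\<lambda>t. matrix_inv s ** t) ` torus_O"
    then obtain v where v: "v \<in> torus_O" "t = matrix_inv s ** v" by auto
    then show "t \<in> {t \<in> torus_F. s ** t \<in> torus_O}"
      using inv by (auto simp: torus_F_mult torus_O_def)
  qed
  moreover have "{t \<in> torus_F. t ** g \<in> unip_ball m} =
      (if n_of g \<le> int m then {t \<in> torus_F. s ** t \<in> torus_O} else {})"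
    using mem by auto
  ultimately show thesis using that[of "matrix_inv s"] inv(1) by simp
qed

section \<open>The line \<open>\<aa>\<^sub>T\<^sup>G\<close>\<close>

lemma aTG_iff: "v \<in> aTG \<longleftrightarrow> v = v $ 1 *\<^sub>R coroot12"
  by (auto simp: aTG_def vec_eq_iff forall_2)

lemma coroot12_aTG [simp]: "r *\<^sub>R coroot12 \<in> aTG"
  by (simp add: aTG_def)

text \<open>Normalizing the coroot shows that the choice in \<open>unit_aTG\<close> is not void. The
  sign of \<open>s\<close> stays open, which is harmless because only its absolute value enters the
  volumes.\<close>

lemma unit_aTG_eq_scaleR_coroot12:
  assumes "weyl_inner_product ip"
  obtains s where "s \<noteq> 0" "unit_aTG ip = s *\<^sub>R coroot12"
proof -
  define N where "N = ip coroot12 coroot12"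
  have c: "coroot12 \<in> aTG" using coroot12_aTG[of 1] by simp
  have "coroot12 \<noteq> 0" by (metis coroot12_nth(1) zero_index zero_neq_one)
  then have N: "N > 0" using assms c by (simp add: N_def weyl_inner_product_def)
  \<comment> \<open>Homogeneity is given in the first argument; the second factor \<open>r\<close>
    comes out by symmetry.\<close>
  have sc: "ip (r *\<^sub>R coroot12) (r *\<^sub>R coroot12) = r * r * N" for r
  proof -
    have "ip (r *\<^sub>R coroot12) (r *\<^sub>R coroot12) = r * ip coroot12 (r *\<^sub>R coroot12)"
      using assms c unfolding weyl_inner_product_def by (meson coroot12_aTG)
    also have "ip coroot12 (r *\<^sub>R coroot12) = ip (r *\<^sub>R coroot12) coroot12"
      using assms c unfolding weyl_inner_product_def by (meson coroot12_aTG)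
    also have "\<dots> = r * N"
      using assms c unfolding weyl_inner_product_def N_def by (meson coroot12_aTG)
    finally show ?thesis by simp
  qed
  have "\<exists>u. u \<in> aTG \<and> ip u u = 1"
    using N by (intro exI[of _ "(1 / sqrt N) *\<^sub>R coroot12"]) (simp add: sc)
  then have u: "unit_aTG ip \<in> aTG" "ip (unit_aTG ip) (unit_aTG ip) = 1"
    unfolding unit_aTG_def by (metis (mono_tags, lifting) someI_ex)+
  obtain s where s: "unit_aTG ip = s *\<^sub>R coroot12" using u(1) aTG_iff by metis
  with u(2) sc[of s] have "s \<noteq> 0" by auto
  with s that show thesis by blast
qed

text \<open>The unit vector is \<open>s\<close> times the coroot, so the coroot has length
  \<open>1 / \<bar>s\<bar>\<close>, the factor from coroot coordinates to the chosen
  measure.\<close>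

lemma measure_leb_aTG:
  assumes ip: "weyl_inner_product ip" and s: "s \<noteq> 0" "unit_aTG ip = s *\<^sub>R coroot12"
    and I: "I \<in> sets borel"
  shows "measure (leb_aTG ip) ((\<lambda>r. r *\<^sub>R coroot12) ` I) = measure lborel I / \<bar>s\<bar>"
proof -
  let ?S = "(\<lambda>r. r *\<^sub>R coroot12) ` I"
  have "?S = aTG \<inter> (\<lambda>v. v $ 1) -` I"
  proof (intro equalityI subsetI)
    fix v assume "v \<in> aTG \<inter> (\<lambda>v. v $ 1) -` I"
    then show "v \<in> ?S" by (intro image_eqI[of _ _ "v $ 1"]) (simp_all flip: aTG_iff)
  qed auto
  moreover have "(\<lambda>v :: real ^ 2. v $ 1) -` I \<in> sets borel"
    using measurable_sets[of "\<lambda>v :: real ^ 2. v $ 1" borel borel I] I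
    by (simp add: borel_measurable_continuous_onI continuous_on_component)
  ultimately have S: "?S \<in> sets (restrict_space borel aTG)"
    by (auto simp: sets_restrict_space)
  have m: "(\<lambda>r. r *\<^sub>R unit_aTG ip) \<in> lborel \<rightarrow>\<^sub>M restrict_space borel aTG"
    by (rule measurable_restrict_space2) (auto simp: s)
  have "(\<lambda>r. r *\<^sub>R unit_aTG ip) -` ?S \<inter> space lborel = (*) s -` I"
    by (auto simp: s vec_eq_iff forall_2 mult.commute)
  then have "measure (leb_aTG ip) ?S = measure lborel ((*) s -` I)"
    unfolding leb_aTG_def using m S by (simp add: measure_distr)
  also have "\<dots> = measure (distr lborel borel ((*) s)) I"
    using I by (simp add: measure_distr)
  also have "\<dots> = measure lborel I / \<bar>s\<bar>"
    using s(1) I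
    by (simp add: lborel_distr_mult measure_def emeasure_density nn_integral_multc
        enn2real_mult divide_inverse mult.commute)
  finally show ?thesis .
qed

text \<open>The chosen generator \<open>b\<close> is the coroot or its negative. In coroot
  coordinates the cell is \<open>{0..<1}\<close> or \<open>{-1<..0}\<close>, of length 1 in both
  cases.\<close>

lemma covolume_cochar_SL2:
  assumes ip: "weyl_inner_product ip" and s: "s \<noteq> 0" "unit_aTG ip = s *\<^sub>R coroot12"
  shows "covolume ip cochar_SL2 = 1 / \<bar>s\<bar>"
proof -
  define b where "b = (SOME b. cochar_SL2 = {of_int m *\<^sub>R b | m. True})"
  have "cochar_SL2 = {of_int m *\<^sub>R coroot12 | m. True}"
  proof (intro equalityI subsetI)
    fix v assume "v \<in> cochar_SL2"
    then have "v \<in> aTG" "v $ 1 \<in> \<int>" by (auto simp: cochar_SL2_def aTG_def)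
    then obtain m where "v $ 1 = of_int m" by (auto elim!: Ints_cases)
    with \<open>v \<in> aTG\<close> have "v = of_int m *\<^sub>R coroot12"
      by (simp add: aTG_def vec_eq_iff forall_2)
    then show "v \<in> {of_int m *\<^sub>R coroot12 | m. True}" by blast
  qed (auto simp: cochar_SL2_def)
  then have c: "cochar_SL2 = {of_int m *\<^sub>R b | m. True}" "cochar_SL2 = {of_int m *\<^sub>R coroot12 | m. True}"
    unfolding b_def by (rule someI, assumption)
  have "b \<in> cochar_SL2" unfolding c(1) by (auto intro: exI[of _ 1])
  then obtain l :: int where l: "b = of_int l *\<^sub>R coroot12" unfolding c(2) by auto
  have "coroot12 \<in> cochar_SL2" unfolding c(2) by (auto intro: exI[of _ 1])
  then obtain m :: int where "coroot12 = of_int m *\<^sub>R b" unfolding c(1) by auto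
  then have "coroot12 $ 1 = (of_int m *\<^sub>R b) $ 1" by simp
  then have "of_int (m * l) = (1 :: real)" by (simp add: l)
  then have "m * l = 1" by linarith
  then have "l = 1 \<or> l = - 1" by (auto simp: zmult_eq_1_iff)
  then have "{r *\<^sub>R b | r. 0 \<le> r \<and> r < 1} = (\<lambda>r. r *\<^sub>R coroot12) ` {0..<1} \<or>
      {r *\<^sub>R b | r. 0 \<le> r \<and> r < 1} = (\<lambda>r. r *\<^sub>R coroot12) ` {-1<..0}"
  proof (elim disjE)
    assume "l = 1"
    then show ?thesis by (auto simp: l)
  next
    assume "l = - 1"
    then have "{r *\<^sub>R b | r. 0 \<le> r \<and> r < 1} = (\<lambda>r. (- r) *\<^sub>R coroot12) ` {0..<1}"
      by (auto simp: l)
    also have "\<dots> = (\<lambda>r. r *\<^sub>R coroot12) ` (uminus ` {0..<1})" by (simp only: image_image)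
    finally show ?thesis by simp
  qed
  then have "measure (leb_aTG ip) {r *\<^sub>R b | r. 0 \<le> r \<and> r < 1} = 1 / \<bar>s\<bar>"
    by (auto simp: measure_leb_aTG[OF ip s])
  moreover have "covolume ip cochar_SL2 = measure (leb_aTG ip) {r *\<^sub>R b | r. 0 \<le> r \<and> r < 1}"
    by (simp only: covolume_def Let_def b_def)
  ultimately show ?thesis by simp
qed

text \<open>The projection moves the segment along the central direction only, so it still spans
  \<open>pole y\<close> coroots, each of length equal to the covolume.\<close>

lemma v_T_eq:
  assumes ip: "weyl_inner_product ip" and g: "g \<in> GL2_F"
  shows "v_T ip g = covolume ip cochar_SL2 * of_int (n_of g)"
proof -
  obtain s where s: "s \<noteq> 0" "unit_aTG ip = s *\<^sub>R coroot12"
    using ip by (rule unit_aTG_eq_scaleR_coroot12)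
  obtain a b y k where *: "a \<noteq> 0" "b \<noteq> 0" "k \<in> GL2_O" and g: "g = torus_elt a b ** unip y ** k"
    using g by (rule iwasawa)
  define w where "w = (of_int (fls_subdegree a) - of_int (fls_subdegree b)) / (2 :: real)"
  have lin: "linear proj_aTG"
    by (rule linearI) (simp_all add: proj_aTG_def vec_eq_iff forall_2 field_simps)
  have "proj_aTG (H_map N_upper g) = w *\<^sub>R coroot12"
    "proj_aTG (H_map N_lower g) = (w - real (pole y)) *\<^sub>R coroot12"
    using * by (simp_all add: g H_map_upper H_map_lower proj_aTG_def vec_eq_iff forall_2 w_def field_simps)
  then have "proj_aTG ` Ec g = (\<lambda>r. r *\<^sub>R coroot12) ` closed_segment w (w - real (pole y))"
    by (simp add: Ec_def closed_segment_linear_image[OF lin, symmetric] closed_segment_coroot12)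
  also have "closed_segment w (w - real (pole y)) = {w - real (pole y)..w}"
    by (auto simp: closed_segment_eq_real_ivl)
  finally show ?thesis
    using measure_leb_aTG[OF ip s, of "{w - real (pole y)..w}"] n_of_eq_pole[OF *, of y]
    by (simp add: v_T_def covolume_cochar_SL2[OF ip s] g)
qed

section \<open>The quotient measure\<close>

lemma mem_coset_T: "g \<in> coset_T g"
  unfolding coset_T_def by (rule image_eqI[of _ _ "mat 1"]) simp_all

lemma coset_T_memE:
  assumes "g \<in> coset_T h"
  obtains t where "t \<in> torus_F" "g = t ** h"
  using assms by (auto simp: coset_T_def)

lemma coset_T_torus_mult:
  assumes t: "t \<in> torus_F"
  shows "coset_T (t ** g) = coset_T g"
proof (intro equalityI subsetI)
  fix h assume "h \<in> coset_T (t ** g)"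
  then obtain s where "s \<in> torus_F" "h = (s ** t) ** g"
    by (auto simp: coset_T_def matrix_mul_assoc)
  then show "h \<in> coset_T g" using t by (auto simp: coset_T_def torus_F_mult)
next
  fix h assume "h \<in> coset_T g"
  then obtain s where s: "s \<in> torus_F" "h = s ** g" by (rule coset_T_memE)
  have "(s ** matrix_inv t) ** (t ** g) = s ** (matrix_inv t ** t) ** g"
    by (simp only: matrix_mul_assoc)
  then have "h = (s ** matrix_inv t) ** (t ** g)"
    using t s by (simp add: matrix_inv_GL2 torus_F_imp_GL2_F)
  then show "h \<in> coset_T (t ** g)"
    using s(1) t torus_F_mult torus_F_matrix_inv unfolding coset_T_def by blast
qed

lemma coset_rep_coset_T:
  assumes "c \<in> coset_T ` GL2_F"
  shows "coset_rep c \<in> GL2_F" "c = coset_T (coset_rep c)"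
proof -
  obtain g where g: "g \<in> GL2_F" "c = coset_T g" using assms by auto
  have "\<exists>h. h \<in> c" using g mem_coset_T by blast
  then have "coset_rep c \<in> c" unfolding coset_rep_def by (rule someI_ex)
  then obtain t where t: "t \<in> torus_F" "coset_rep c = t ** g" by (auto simp: g coset_T_def)
  then show "coset_rep c \<in> GL2_F" using g by (simp add: GL2_F_mult torus_F_imp_GL2_F)
  show "c = coset_T (coset_rep c)"
    unfolding t(2) coset_T_torus_mult[OF t(1)] by (rule g(2))
qed

definition T_cosets_le :: "nat \<Rightarrow> 'a::{field,finite} mat2 set set" where
  "T_cosets_le m = {c \<in> coset_T ` GL2_F. n_of (coset_rep c) \<le> int m}"

text \<open>\<open>quotient_measure\<close> decides measurability by the union of the cosets. As
  \<open>n_of\<close> is constant on each coset, the chosen representative disappears from this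
  union.\<close>

lemma Union_T_cosets_le:
  "\<Union>(T_cosets_le m) = {g :: 'a::{field,finite} mat2. g \<in> GL2_F \<and> n_of g \<le> int m}"
proof (intro equalityI subsetI)
  fix g :: "'a mat2" assume "g \<in> \<Union>(T_cosets_le m)"
  then obtain c where c: "c \<in> coset_T ` GL2_F" "n_of (coset_rep c) \<le> int m" "g \<in> c"
    by (auto simp: T_cosets_le_def)
  then obtain t where "t \<in> torus_F" "g = t ** coset_rep c"
    using coset_rep_coset_T(2)[OF c(1)] by (auto simp: coset_T_def)
  then show "g \<in> {g. g \<in> GL2_F \<and> n_of g \<le> int m}"
    using c coset_rep_coset_T(1)[OF c(1)] by (simp add: n_of_torus_left GL2_F_mult torus_F_imp_GL2_F)
next
  fix g :: "'a mat2" assume g: "g \<in> {g. g \<in> GL2_F \<and> n_of g \<le> int m}"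
  have c: "coset_T g \<in> coset_T ` GL2_F" using g by simp
  have "g \<in> coset_T (coset_rep (coset_T g))"
    by (rule equalityD1[OF coset_rep_coset_T(2)[OF c], THEN subsetD, OF mem_coset_T])
  then obtain t where t: "t \<in> torus_F" "g = t ** coset_rep (coset_T g)"
    by (rule coset_T_memE)
  have "n_of (coset_rep (coset_T g)) = n_of g"
    using n_of_torus_left[OF t(1) coset_rep_coset_T(1)[OF c]] by (simp only: t(2)[symmetric])
  then have "coset_T g \<in> T_cosets_le m" using g c by (simp add: T_cosets_le_def)
  then show "g \<in> \<Union>(T_cosets_le m)" using mem_coset_T by blast
qed

lemma haar_measure_open_in_sets:
  assumes "haar_measure H M" "open S" "S \<subseteq> H"
  shows "S \<in> sets M"
proof -
  have "S = H \<inter> S" using assms by auto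
  then show ?thesis using assms by (auto simp: haar_measure_def sets_restrict_space)
qed

text \<open>Non-measurable sets get \<open>emeasure\<close> 0 by convention, so the normalizations
  of the Haar measures already make K and T(O) measurable.\<close>

lemma emeasure_eq_1_imp_sets: "emeasure M A = 1 \<Longrightarrow> A \<in> sets M"
  using emeasure_notin_sets by fastforce

lemma haar_measure_translate:
  assumes "haar_measure H M" "h \<in> H" "emeasure M A = 1"
  shows "emeasure M ((\<lambda>x. h ** x) ` A) = 1"
proof -
  have "A \<in> sets M" using assms(3) by (rule emeasure_eq_1_imp_sets)
  then show ?thesis using assms by (simp add: haar_measure_def)
qed

lemma emeasure_unip_ball:
  fixes dg :: "'a::{field,finite} mat2 measure"
  assumes dg: "haar_measure GL2_F dg" "emeasure dg GL2_O = 1"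
  shows "emeasure dg (unip_ball m) = of_nat (CARD('a) ^ m)"
proof -
  have one: "emeasure dg (coset_K (unip r)) = 1" for r
    unfolding coset_K_def using dg by (intro haar_measure_translate) auto
  have "disjoint_family_on (\<lambda>r. coset_K (unip r)) (principal_parts m :: 'a fls set)"
    unfolding disjoint_family_on_def
  proof (intro ballI impI)
    fix r s :: "'a fls" assume rs: "r \<in> principal_parts m" "s \<in> principal_parts m" "r \<noteq> s"
    have "r - s \<in> integers" if h: "h \<in> coset_K (unip r)" "h \<in> coset_K (unip s)" for h
    proof -
      obtain k l where kl: "k \<in> GL2_O" "l \<in> GL2_O" "h = unip r ** k" "h = unip s ** l"
        using h by (auto simp: coset_K_def)
      then have "coset_K (unip r) = coset_K (unip s)"
        by (metis coset_K_eq_iff unip_GL2_F)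
      then have "coset_K (torus_elt 1 1 ** unip r) = coset_K (torus_elt 1 1 ** unip s)"
        by (simp add: torus_elt_def flip: mat_1_eq_mat22)
      then show ?thesis by (subst (asm) coset_K_torus_unip_eq_iff) auto
    qed
    then show "coset_K (unip r) \<inter> coset_K (unip s) = {}"
      using rs principal_parts_eqI by blast
  qed
  then have "emeasure dg (unip_ball m) = (\<Sum>r\<in>principal_parts m. emeasure dg (coset_K (unip r)))"
    unfolding unip_ball_def
    by (intro sum_emeasure[symmetric]) (auto intro: emeasure_eq_1_imp_sets one)
  then show ?thesis by (simp add: one card_principal_parts)
qed

section \<open>Measures of the level sets and the two integrals\<close>

context
  fixes dg dt :: "'a::{field,finite} mat2 measure" and Q :: "'a mat2 set measure"
  assumes dg: "haar_measure GL2_F dg" "emeasure dg GL2_O = 1"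
    and dt: "haar_measure torus_F dt" "emeasure dt torus_O = 1"
    and Q: "quotient_measure dg dt Q"
begin

lemma T_cosets_le_sets: "T_cosets_le m \<in> sets Q"
proof -
  have "open {g :: 'a mat2. g \<in> GL2_F \<and> n_of g \<le> int m}"
    by (rule open_right_GL2_O_invariant) (auto simp: n_of_GL2_O_right GL2_F_mult GL2_O_imp_GL2_F)
  then have "{g. g \<in> GL2_F \<and> n_of g \<le> int m} \<in> sets dg"
    by (rule haar_measure_open_in_sets[OF dg(1)]) auto
  moreover have "T_cosets_le m \<subseteq> coset_T ` (GL2_F :: 'a mat2 set)" by (auto simp: T_cosets_le_def)
  ultimately show ?thesis using Q by (simp add: quotient_measure_def Union_T_cosets_le)
qed

lemma emeasure_T_cosets_le: "emeasure Q (T_cosets_le m) = of_nat (CARD('a) ^ m)"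
proof -
  let ?f = "indicator (unip_ball m) :: 'a mat2 \<Rightarrow> ennreal"
  have sp: "space Q = coset_T ` GL2_F" "space dt = torus_F"
    using Q dt by (simp_all add: quotient_measure_def haar_measure_def)
  have Q_integral: "(\<integral>\<^sup>+ g. f g \<partial>dg) = (\<integral>\<^sup>+ c. (\<integral>\<^sup>+ t. f (t ** coset_rep c) \<partial>dt) \<partial>Q)"
    if "f \<in> borel_measurable dg" for f
    by (rule Q[unfolded quotient_measure_def, THEN conjunct2, THEN conjunct2, rule_format, OF that])
  have ball: "unip_ball m \<in> sets dg"
    by (rule haar_measure_open_in_sets[OF dg(1) open_unip_ball unip_ball_subset])
  \<comment> \<open>The orbit integral is the volume of a translate of T(O) or of the empty set,
    whichever representative \<open>coset_rep\<close> picks.\<close>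
  have inner: "(\<integral>\<^sup>+ t. ?f (t ** coset_rep c) \<partial>dt) = indicator (T_cosets_le m) c"
    if c: "c \<in> space Q" for c
  proof -
    let ?A = "{t \<in> torus_F. t ** coset_rep c \<in> unip_ball m}"
    have "coset_rep c \<in> GL2_F" using c by (simp add: sp coset_rep_coset_T)
    then obtain s where s: "s \<in> torus_F"
      "?A = (if n_of (coset_rep c) \<le> int m then (\<lambda>t. s ** t) ` torus_O else {})"
      by (rule torus_translate_unip_ball)
    have A: "emeasure dt ?A = indicator (T_cosets_le m) c"
      using haar_measure_translate[OF dt(1) s(1) dt(2)] c
      by (subst s(2)) (simp add: T_cosets_le_def sp)
    have "?A \<in> sets dt"
      unfolding s(2) using emeasure_eq_1_imp_sets[OF haar_measure_translate[OF dt(1) s(1) dt(2)]] by simp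
    moreover have "(\<integral>\<^sup>+ t. ?f (t ** coset_rep c) \<partial>dt) = (\<integral>\<^sup>+ t. indicator ?A t \<partial>dt)"
      by (rule nn_integral_cong) (simp add: sp indicator_def)
    ultimately show ?thesis using A by simp
  qed
  have "of_nat (CARD('a) ^ m) = (\<integral>\<^sup>+ g. ?f g \<partial>dg)"
    using ball emeasure_unip_ball[OF dg] by simp
  also have "\<dots> = (\<integral>\<^sup>+ c. (\<integral>\<^sup>+ t. ?f (t ** coset_rep c) \<partial>dt) \<partial>Q)"
    using Q_integral borel_measurable_indicator[OF ball] by blast
  also have "\<dots> = (\<integral>\<^sup>+ c. indicator (T_cosets_le m) c \<partial>Q)"
    by (rule nn_integral_cong) (rule inner)
  also have "\<dots> = emeasure Q (T_cosets_le m)" using T_cosets_le_sets by simp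
  finally show ?thesis ..
qed

lemma measure_T_cosets_le: "measure Q (T_cosets_le m) = real CARD('a) ^ m"
  by (simp add: measure_def emeasure_T_cosets_le enn2real_of_nat flip: of_nat_power)

lemma integrable_T_cosets_le: "integrable Q (indicat_real (T_cosets_le m))"
  using T_cosets_le_sets
  by (intro integrable_real_indicator) (simp_all add: emeasure_T_cosets_le of_nat_less_top del: of_nat_power)

context
  fixes \<gamma> :: "'a mat2" and n :: nat
  assumes \<gamma>: "\<gamma> \<in> torus_lie_O" "regular_element \<gamma>" "fls_subdegree (alpha12 \<gamma>) = int n"
begin

lemma Ad_coset_rep_indicator:
  assumes c: "c \<in> space Q"
  shows "indicat_real gl2_int (Ad (matrix_inv (coset_rep c)) \<gamma>) = indicat_real (T_cosets_le n) c"
proof -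
  have c': "c \<in> coset_T ` GL2_F" using c Q by (simp add: quotient_measure_def)
  then have "coset_rep c \<in> GL2_F" by (rule coset_rep_coset_T)
  then obtain a b y k where *: "a \<noteq> 0" "b \<noteq> 0" "k \<in> GL2_O"
    "coset_rep c = torus_elt a b ** unip y ** k" by (rule iwasawa)
  then show ?thesis
    using Ad_gl2_int_iff[OF \<gamma> *(1-3), of y] n_of_eq_pole[OF *(1-3), of y] c'
    by (simp add: indicator_def T_cosets_le_def)
qed

lemma orbital_integral_eq: "orbital_integral Q \<gamma> = real CARD('a) ^ n"
proof -
  have "orbital_integral Q \<gamma> = (LINT c|Q. indicat_real (T_cosets_le n) c)"
    unfolding orbital_integral_def by (rule Bochner_Integration.integral_cong) (auto simp: Ad_coset_rep_indicator)
  then show ?thesis using T_cosets_le_sets by (simp add: measure_T_cosets_le)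
qed

text \<open>On the level set of \<open>n\<close> the weight is the covolume times the pole order, a
  layered sum over \<open>j\<close>; linearity then needs only the measures of the level
  sets.\<close>

lemma weighted_orbital_integral_eq:
  assumes ip: "weyl_inner_product ip"
  shows "weighted_orbital_integral ip Q \<gamma> =
    covolume ip cochar_SL2 * (real n * real CARD('a) ^ n - (\<Sum>j<n. real CARD('a) ^ j))"
proof -
  let ?v = "covolume ip cochar_SL2"
  have "indicat_real gl2_int (Ad (matrix_inv (coset_rep c)) \<gamma>) * v_T ip (coset_rep c) =
      ?v * (\<Sum>j<n. indicat_real (T_cosets_le n) c - indicat_real (T_cosets_le j) c)"
    if c: "c \<in> space Q" for c
  proof -
    have c': "c \<in> coset_T ` GL2_F" using c Q by (simp add: quotient_measure_def)
    then have g: "coset_rep c \<in> GL2_F" by (rule coset_rep_coset_T)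
    then obtain a b y k where *: "a \<noteq> 0" "b \<noteq> 0" "k \<in> GL2_O"
      "coset_rep c = torus_elt a b ** unip y ** k" by (rule iwasawa)
    then have p: "n_of (coset_rep c) = int (pole y)" by (simp add: n_of_eq_pole)
    have mem: "c \<in> T_cosets_le j \<longleftrightarrow> pole y \<le> j" for j
      using c' p by (simp add: T_cosets_le_def)
    \<comment> \<open>If \<open>pole y \<le> n\<close>, exactly the \<open>j\<close> below
      \<open>pole y\<close> contribute 1. If \<open>pole y > n\<close>, both indicators vanish for
      every \<open>j < n\<close>.\<close>
    have "indicat_real (T_cosets_le n) c * real (pole y) =
        (\<Sum>j<n. indicat_real (T_cosets_le n) c - indicat_real (T_cosets_le j) c)"
    proof (cases "pole y \<le> n")
      case True
      have "(\<Sum>j<n. indicat_real (T_cosets_le n) c - indicat_real (T_cosets_le j) c) =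
          (\<Sum>j<n. if j < pole y then 1 else 0)"
        using True by (intro sum.cong) (auto simp: indicator_def mem)
      also have "\<dots> = real (card ({..<n} \<inter> {j. j < pole y}))"
        by (simp add: sum.If_cases)
      also have "{..<n} \<inter> {j. j < pole y} = {..<pole y}" using True by auto
      finally show ?thesis using True by (simp add: indicator_def mem)
    next
      case False
      then show ?thesis by (simp add: indicator_def mem)
    qed
    then show ?thesis using g by (simp add: Ad_coset_rep_indicator[OF c] v_T_eq[OF ip] p)
  qed
  then have "weighted_orbital_integral ip Q \<gamma> =
      (LINT c|Q. ?v * (\<Sum>j<n. indicat_real (T_cosets_le n) c - indicat_real (T_cosets_le j) c))"
    unfolding weighted_orbital_integral_def by (intro Bochner_Integration.integral_cong) simp_all
  also have "\<dots> = ?v * (\<Sum>j<n. measure Q (T_cosets_le n) - measure Q (T_cosets_le j))"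
    using integrable_T_cosets_le T_cosets_le_sets
    by (simp add: Bochner_Integration.integral_sum Bochner_Integration.integral_diff)
  finally show ?thesis by (simp add: measure_T_cosets_le sum_subtractf)
qed

end

end

theorem theorem5p1:
  fixes \<gamma> :: "'a::{field,finite} mat2"
    and n :: nat
    and x0 :: "'a mat2"
    and ip :: "real ^ 2 \<Rightarrow> real ^ 2 \<Rightarrow> real"
    and dg dt :: "'a mat2 measure"
    and Q :: "'a mat2 set measure"
  assumes char: "CHAR('a) > 2"
    and gamma: "\<gamma> \<in> torus_lie_O" "regular_element \<gamma>"
    and root_valuation: "fls_subdegree (alpha12 \<gamma>) = int n" "n \<ge> 1"
    and base_point: "coset_K x0 \<in> springer_fibre0 \<gamma>" "regular_point \<gamma> x0"
    and ip: "weyl_inner_product ip"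
    and dg: "haar_measure GL2_F dg" "emeasure dg GL2_O = 1"
    and dt: "haar_measure torus_F dt" "emeasure dt torus_O = 1"
    and Q: "quotient_measure dg dt Q"
  shows "orbital_integral Q \<gamma> = real CARD('a) ^ n \<and>
    (\<forall>\<^sub>F a in sequentially.
       card (springer_fibre0_trunc \<gamma> (family_segment (Pi_vertex x0 a)))
         = (\<Sum>i=0..n. CARD('a) ^ i) + 2 * a * CARD('a) ^ n) \<and>
    weighted_orbital_integral ip Q \<gamma>
      = covolume ip cochar_SL2 * (real n * real CARD('a) ^ n - (\<Sum>i=0..n-1. real CARD('a) ^ i))"
proof -
  note \<gamma> = gamma root_valuation(1)
  \<comment> \<open>This uses \<open>n \<ge> 1\<close>: at \<open>n = 0\<close> the left side would
    be \<open>{0}\<close> by truncated subtraction.\<close>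
  have "{0..n-1} = {..<n}" using root_valuation(2) by auto
  then show ?thesis
    using orbital_integral_eq[OF dg dt Q \<gamma>] weighted_orbital_integral_eq[OF dg dt Q \<gamma> ip]
      card_springer_fibre0_trunc[OF \<gamma> base_point] by simp
qed

end
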